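(* Let $G=\mathrm{GIRG}(n,\beta,w_0,d)$ be a standard GIRG and let $U_k=\{v_1,\dots,v_k\}$ be a set of $k$ vertices chosen uniformly at random with weights $w_1\le\dots\le w_k$, and let $\mathcal{W}_k=\{w_1,\dots,w_k\}$. Let $\mathcal{E}^c_{\mathrm{star}}$ be the event that $v_1$ is adjacent to all vertices of $U_k\setminus\{v_1\}$ and that $w_k\le c^dw_1$, for some constant $c\ge1$ with $c^2(w_1^2/(\tau n))^{1/d}\le1/4$. Then $\Pr[U_k\text{ is a clique}\mid \mathcal{E}^c_{\mathrm{star}},\mathcal{W}_k]$ is monotonically increasing in each of $w_2,\dots,w_k$.
   Context: Fix constants $\lambda>0$, $w_0>0$, $\beta>2$. A standard GIRG $\mathrm{GIRG}(n,\beta,w_0,d)$ has $n$ vertices; each vertex $v$ independently receives a weight $w_v$ with $\Pr[w_v\le x]=1-(x/w_0)^{1-\beta}$ for $x\ge w_0$, and independently a position $\mathbf{x}_v$ uniform on the torus $\mathbb{T}^d=[0,1)^d$. The distance is $d(\mathbf{x}_u,\mathbf{x}_v)=\max_{1\le i\le d}|x_{ui}-x_{vi}|_C$ with $|a-b|_C=\min\{|a-b|,1-|a-b|\}$. Distinct $u,v$ are adjacent iff $d(\mathbf{x}_u,\mathbf{x}_v)\le t_{uv}=\big(\frac{w_uw_v}{\tau n}\big)^{1/d}$, where $\tau=2^d/\lambda$. *)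

theory Defs
  imports "HOL-Probability.Probability"
begin

text \<open>
  Vertices are natural numbers. A weighting is a function from vertices to reals; a
  configuration of positions is a function from vertices to points of the torus, and a point of
  the \<open>d\<close>-dimensional torus is an (extensional) function on \<open>{..<d}\<close> with values in \<open>[0, 1)\<close>.
\<close>

definition circle_dist :: "real \<Rightarrow> real \<Rightarrow> real" where
  "circle_dist a b = min \<bar>a - b\<bar> (1 - \<bar>a - b\<bar>)"

definition torus_dist :: "nat \<Rightarrow> (nat \<Rightarrow> real) \<Rightarrow> (nat \<Rightarrow> real) \<Rightarrow> real" where
  "torus_dist d p q = Max ((\<lambda>j. circle_dist (p j) (q j)) ` {..<d})"

definition torus_uniform :: "nat \<Rightarrow> (nat \<Rightarrow> real) measure" where
  "torus_uniform d = Pi\<^sub>M {..<d} (\<lambda>_. uniform_measure lborel {0..<1})"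

definition weight_cdf :: "real \<Rightarrow> real \<Rightarrow> real \<Rightarrow> real" where
  "weight_cdf \<beta> w\<^sub>0 x = (if w\<^sub>0 \<le> x then 1 - (x / w\<^sub>0) powr (1 - \<beta>) else 0)"

definition weight_law :: "real \<Rightarrow> real \<Rightarrow> real measure" where
  "weight_law \<beta> w\<^sub>0 = interval_measure (weight_cdf \<beta> w\<^sub>0)"

text \<open>The joint law of all weights and all positions.\<close>

definition girg ::
    "nat \<Rightarrow> real \<Rightarrow> real \<Rightarrow> nat \<Rightarrow> ((nat \<Rightarrow> real) \<times> (nat \<Rightarrow> nat \<Rightarrow> real)) measure" where
  "girg n \<beta> w\<^sub>0 d =
     Pi\<^sub>M {1..n} (\<lambda>_. weight_law \<beta> w\<^sub>0) \<Otimes>\<^sub>M Pi\<^sub>M {1..n} (\<lambda>_. torus_uniform d)"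

definition girg_tau :: "real \<Rightarrow> nat \<Rightarrow> real" where
  "girg_tau lam d = 2 ^ d / lam"

definition threshold :: "real \<Rightarrow> nat \<Rightarrow> nat \<Rightarrow> real \<Rightarrow> real \<Rightarrow> real" where
  "threshold lam n d a b = (a * b / (girg_tau lam d * real n)) powr (1 / real d)"

definition adjacent ::
    "real \<Rightarrow> nat \<Rightarrow> nat \<Rightarrow> (nat \<Rightarrow> real) \<Rightarrow> (nat \<Rightarrow> nat \<Rightarrow> real) \<Rightarrow> nat \<Rightarrow> nat \<Rightarrow> bool" where
  "adjacent lam n d w x u v \<longleftrightarrow>
     u \<noteq> v \<and> torus_dist d (x u) (x v) \<le> threshold lam n d (w u) (w v)"

definition is_clique ::
    "real \<Rightarrow> nat \<Rightarrow> nat \<Rightarrow> (nat \<Rightarrow> real) \<Rightarrow> (nat \<Rightarrow> nat \<Rightarrow> real) \<Rightarrow> nat set \<Rightarrow> bool" where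
  "is_clique lam n d w x U \<longleftrightarrow> (\<forall>u\<in>U. \<forall>v\<in>U. u \<noteq> v \<longrightarrow> adjacent lam n d w x u v)"

text \<open>Here \<open>v 1, \<dots>, v k\<close> is an enumeration of the chosen vertices by increasing weight.\<close>

definition is_star ::
    "real \<Rightarrow> nat \<Rightarrow> nat \<Rightarrow> real \<Rightarrow> nat \<Rightarrow> (nat \<Rightarrow> real) \<Rightarrow> (nat \<Rightarrow> nat \<Rightarrow> real) \<Rightarrow> (nat \<Rightarrow> nat) \<Rightarrow> bool"
  where
  "is_star lam n d c k w x v \<longleftrightarrow>
     (\<forall>i\<in>{2..k}. adjacent lam n d w x (v 1) (v i)) \<and> w (v k) \<le> c ^ d * w (v 1)"

text \<open>A GIRG together with an independent, uniformly random set of \<open>k\<close> of its vertices.\<close>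

definition girg_subset ::
    "nat \<Rightarrow> real \<Rightarrow> real \<Rightarrow> nat \<Rightarrow> nat \<Rightarrow>
     (((nat \<Rightarrow> real) \<times> (nat \<Rightarrow> nat \<Rightarrow> real)) \<times> nat set) measure" where
  "girg_subset n \<beta> w\<^sub>0 d k =
     girg n \<beta> w\<^sub>0 d \<Otimes>\<^sub>M uniform_count_measure {U. U \<subseteq> {1..n} \<and> card U = k}"

text \<open>
  The \<open>i\<close>-th vertex of \<open>U\<close> (counting from 1) in order of weight; ties, which occur with
  probability 0, are broken by vertex number.
\<close>

definition ranked :: "(nat \<Rightarrow> real) \<Rightarrow> nat set \<Rightarrow> nat \<Rightarrow> nat" where
  "ranked w U i = sort_key w (sorted_list_of_set U) ! (i - 1)"

definition sorted_weights ::
    "nat \<Rightarrow> ((nat \<Rightarrow> real) \<times> (nat \<Rightarrow> nat \<Rightarrow> real)) \<times> nat set \<Rightarrow> nat \<Rightarrow> real" where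
  "sorted_weights k = (\<lambda>((w, x), U). \<lambda>i\<in>{1..k}. w (ranked w U i))"

definition star_event ::
    "real \<Rightarrow> nat \<Rightarrow> real \<Rightarrow> real \<Rightarrow> nat \<Rightarrow> real \<Rightarrow> nat \<Rightarrow>
     (((nat \<Rightarrow> real) \<times> (nat \<Rightarrow> nat \<Rightarrow> real)) \<times> nat set) set" where
  "star_event lam n \<beta> w\<^sub>0 d c k =
     {((w, x), U) \<in> space (girg_subset n \<beta> w\<^sub>0 d k). is_star lam n d c k w x (ranked w U)}"

definition clique_event ::
    "real \<Rightarrow> nat \<Rightarrow> real \<Rightarrow> real \<Rightarrow> nat \<Rightarrow> nat \<Rightarrow>
     (((nat \<Rightarrow> real) \<times> (nat \<Rightarrow> nat \<Rightarrow> real)) \<times> nat set) set" where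
  "clique_event lam n \<beta> w\<^sub>0 d k =
     {((w, x), U) \<in> space (girg_subset n \<beta> w\<^sub>0 d k). is_clique lam n d w x U}"

text \<open>
  \<open>p\<close> is a version of the conditional probability of \<open>A\<close> given the event \<open>E\<close> and the
  \<open>N\<close>-valued random variable \<open>X\<close>, as a function of the value of \<open>X\<close>.
\<close>

definition is_cond_prob ::
    "'a measure \<Rightarrow> 'a set \<Rightarrow> 'a set \<Rightarrow> ('a \<Rightarrow> 'b) \<Rightarrow> 'b measure \<Rightarrow> ('b \<Rightarrow> real) \<Rightarrow> bool" where
  "is_cond_prob M A E X N p \<longleftrightarrow>
     (AE \<omega> in uniform_measure M E.
        real_cond_exp (uniform_measure M E) (vimage_algebra (space M) X N) (indicator A) \<omega>
        = p (X \<omega>))"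

text \<open>
  Conditioning on the weights has probability 0 for each single weight vector, so the conditional
  probability as a function of the weights is only determined up to null sets. The following is
  the canonical pointwise version: given the weights \<open>w 1 \<le> \<dots> \<le> w k\<close> of the chosen vertices
  (named \<open>1, \<dots>, k\<close> here), their positions are still independent and uniform.
\<close>

definition clique_prob ::
    "real \<Rightarrow> nat \<Rightarrow> nat \<Rightarrow> real \<Rightarrow> nat \<Rightarrow> (nat \<Rightarrow> real) \<Rightarrow> real" where
  "clique_prob lam n d c k w =
     \<P>(x in Pi\<^sub>M {1..k} (\<lambda>_. torus_uniform d).
        is_clique lam n d w x {1..k} \<bar> is_star lam n d c k w x (\<lambda>i. i))"

text \<open>
  The weight vectors \<open>w 1 \<le> \<dots> \<le> w k\<close> under consideration: on these, the weight condition of the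
  star event and the smallness condition on \<open>c\<close> hold.
\<close>

definition admissible ::
    "real \<Rightarrow> nat \<Rightarrow> real \<Rightarrow> nat \<Rightarrow> real \<Rightarrow> nat \<Rightarrow> (nat \<Rightarrow> real) \<Rightarrow> bool" where
  "admissible lam n w\<^sub>0 d c k w \<longleftrightarrow>
     w\<^sub>0 \<le> w 1 \<and> mono_on {1..k} w \<and> w k \<le> c ^ d * w 1 \<and>
     c\<^sup>2 * ((w 1)\<^sup>2 / (girg_tau lam d * real n)) powr (1 / real d) \<le> 1 / 4"

end

theory Submission
  imports Defs
begin

text \<open>
  Fix all positions but that of \<open>v\<^sub>i\<close> and move \<open>w\<^sub>i\<close> from \<open>s\<close> to \<open>s' \<ge> s\<close>. Every threshold at \<open>v\<^sub>i\<close> grows by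
  the factor \<open>r = (s' / s)\<^bsup>1/d\<^esup>\<close>, so the region for \<open>v\<^sub>i\<close> allowed by the star, a cube about \<open>v\<^sub>1\<close>, grows in
  volume by exactly \<open>r\<^sup>d\<close>. The smallness condition on \<open>c\<close> makes all distances involved Euclidean, and
  dilating by \<open>r\<close> about \<open>v\<^sub>1\<close> maps the region allowed by the clique for \<open>s\<close> into that for \<open>s'\<close>, whose
  volume therefore grows by at least \<open>r\<^sup>d\<close>. Integrating over the other positions, the quotient of the two
  probabilities increases.

  That \<open>clique_prob\<close> is the conditional probability follows from Fubini: given weights and \<open>U\<close>, sorting the
  chosen vertices by weight is a fixed reindexing, which preserves the product law of the positions.
\<close>

section \<open>The uniform law on the circle\<close>

text \<open>\<open>int_dist\<close> is the periodic extension of the circle metric. It is needed because \<open>circle_dist\<close> has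
  junk values off \<open>[0, 1)\<close>, while dilations about a point leave this fundamental domain.\<close>

definition int_dist :: "real \<Rightarrow> real" where
  "int_dist y = min (frac y) (1 - frac y)"

lemma int_dist_borel [measurable]: "int_dist \<in> borel_measurable borel"
  unfolding int_dist_def frac_def by measurable

lemma int_dist_add_int: "int_dist (y + of_int m) = int_dist y"
  by (simp add: int_dist_def frac_def)

lemma int_dist_eq_abs: "\<bar>y\<bar> \<le> 1/2 \<Longrightarrow> int_dist y = \<bar>y\<bar>"
proof (cases "y \<ge> 0")
  case True
  assume "\<bar>y\<bar> \<le> 1/2"
  then have "frac y = y" using True by (simp add: frac_eq)
  then show ?thesis using True \<open>\<bar>y\<bar> \<le> 1/2\<close> by (simp add: int_dist_def)
next
  case False
  assume "\<bar>y\<bar> \<le> 1/2"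
  then have "frac y = y + 1" using False by (intro frac_unique_iff[THEN iffD2]) auto
  then show ?thesis using False \<open>\<bar>y\<bar> \<le> 1/2\<close> by (simp add: int_dist_def)
qed

lemma circle_dist_commute: "circle_dist a b = circle_dist b a"
  by (simp add: circle_dist_def abs_minus_commute)

lemma circle_dist_eq_int_dist:
  assumes "a \<in> {0..<1}" "b \<in> {0..<1}"
  shows "circle_dist a b = int_dist (a - b)"
proof (cases "a \<ge> b")
  case True
  then have "frac (a - b) = a - b" using assms by (simp add: frac_eq)
  then show ?thesis using True by (simp add: int_dist_def circle_dist_def)
next
  case False
  then have "frac (a - b) = a - b + 1" using assms by (intro frac_unique_iff[THEN iffD2]) auto
  then show ?thesis using False by (simp add: int_dist_def circle_dist_def min.commute)
qed

section \<open>Lebesgue measure of one-periodic sets\<close>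

lemma emeasure_lborel_translate:
  fixes S :: "real set"
  assumes [measurable]: "S \<in> sets borel"
  shows "emeasure lborel {u. p + u \<in> S} = emeasure lborel S"
proof -
  have "emeasure lborel S = (\<integral>\<^sup>+x. indicator S x \<partial>lborel)"
    using assms by simp
  also have "\<dots> = (\<integral>\<^sup>+x. indicator S (p + 1 * x) \<partial>lborel)"
    using nn_integral_real_affine[of "indicator S" 1 p] assms by simp
  also have "\<dots> = (\<integral>\<^sup>+x. indicator {u. p + u \<in> S} x \<partial>lborel)"
    by (intro nn_integral_cong) (simp add: indicator_def)
  also have "\<dots> = emeasure lborel {u. p + u \<in> S}"
    using assms by (intro nn_integral_indicator) measurable
  finally show ?thesis ..
qed

text \<open>Cut the window at 1. The part beyond 1, moved left by one period, is exactly the missing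
  part \<open>{0..<q}\<close> of the standard window.\<close>

lemma emeasure_periodic_window:
  fixes P :: "real \<Rightarrow> bool"
  assumes [measurable]: "Measurable.pred borel P" and per: "\<And>z. P (z + 1) = P z"
    and q: "0 \<le> q" "q \<le> 1"
  shows "emeasure lborel {z\<in>{q..<q+1}. P z} = emeasure lborel {z\<in>{0..<1}. P z}"
proof -
  have "emeasure lborel {z\<in>{q..<q+1}. P z}
      = emeasure lborel {z\<in>{q..<1}. P z} + emeasure lborel {z\<in>{1..<q+1}. P z}"
    using q by (subst plus_emeasure) (auto intro!: arg_cong[where f = "emeasure lborel"])
  also have "emeasure lborel {z\<in>{1..<q+1}. P z} = emeasure lborel {u. 1 + u \<in> {z\<in>{1..<q+1}. P z}}"
    by (intro emeasure_lborel_translate[symmetric]) measurable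
  also have "{u. 1 + u \<in> {z\<in>{1..<q+1}. P z}} = {z\<in>{0..<q}. P z}"
    using per by (auto simp: add.commute)
  also have "emeasure lborel {z\<in>{q..<1}. P z} + emeasure lborel {z\<in>{0..<q}. P z}
      = emeasure lborel {z\<in>{0..<1}. P z}"
    using q by (subst plus_emeasure) (auto intro!: arg_cong[where f = "emeasure lborel"])
  finally show ?thesis .
qed

text \<open>Passing to the displacement \<open>u\<close> from \<open>p\<close> makes circle balls
  about \<open>p\<close> into intervals about 0. The window around \<open>p\<close> starts at
  \<open>p - 1/2\<close>, which lies in the range allowed by \<open>emeasure_periodic_window\<close>
  only if \<open>p >= 1/2\<close>; otherwise the window around \<open>p + 1\<close> is used.\<close>

lemma emeasure_periodic_centred:
  fixes P :: "real \<Rightarrow> bool"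
  assumes [measurable]: "Measurable.pred borel P" and per: "\<And>z. P (z + 1) = P z"
    and p: "p \<in> {0..<1}"
  shows "emeasure lborel {z\<in>{0..<1}. P z} = emeasure lborel {u\<in>{-1/2..<1/2}. P (p + u)}"
proof (cases "p \<ge> 1/2")
  case True
  have "emeasure lborel {u\<in>{-1/2..<1/2}. P (p + u)}
      = emeasure lborel {u. p + u \<in> {z\<in>{p-1/2..<p-1/2+1}. P z}}"
    by (auto intro!: arg_cong[where f = "emeasure lborel"])
  also have "\<dots> = emeasure lborel {z\<in>{p-1/2..<p-1/2+1}. P z}"
    by (intro emeasure_lborel_translate) measurable
  also have "\<dots> = emeasure lborel {z\<in>{0..<1}. P z}"
    using True p by (intro emeasure_periodic_window per) auto
  finally show ?thesis ..
next
  case False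
  have "P (p + 1 + u) = P (p + u)" for u
    using per[of "p + u"] by (simp add: algebra_simps)
  then have "emeasure lborel {u\<in>{-1/2..<1/2}. P (p + u)}
      = emeasure lborel {u. (p+1) + u \<in> {z\<in>{p+1/2..<p+1/2+1}. P z}}"
    by (auto intro!: arg_cong[where f = "emeasure lborel"])
  also have "\<dots> = emeasure lborel {z\<in>{p+1/2..<p+1/2+1}. P z}"
    by (intro emeasure_lborel_translate) measurable
  also have "\<dots> = emeasure lborel {z\<in>{0..<1}. P z}"
    using False p by (intro emeasure_periodic_window per) auto
  finally show ?thesis ..
qed

abbreviation circle_uniform :: "real measure" where
  "circle_uniform \<equiv> uniform_measure lborel {0..<1}"

lemma circle_dist_borel [measurable (raw)]:
  assumes [measurable]: "f \<in> borel_measurable M" "g \<in> borel_measurable M"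
  shows "(\<lambda>x. circle_dist (f x) (g x)) \<in> borel_measurable M"
  unfolding circle_dist_def by measurable

lemma emeasure_circle_uniform:
  assumes "Measurable.pred borel P"
  shows "emeasure circle_uniform {z. P z} = emeasure lborel {z\<in>{0..<1}. P z}"
proof -
  have "{0..<1} \<inter> {z. P z} = {z\<in>{0..<1}. P z}" by auto
  moreover have "{z. P z} \<in> sets borel" using assms by measurable
  ultimately show ?thesis
    by (simp add: divide_ennreal_def)
qed

text \<open>In centred coordinates the ball is the interval from \<open>-h\<close> to
  \<open>h\<close>, and \<open>h <= 1/4\<close> keeps it inside the window. The value is exact,
  which the star needs: an inequality would not suffice in a denominator.\<close>

lemma emeasure_circle_ball:
  assumes p: "p \<in> {0..<1}" and h: "0 \<le> h" "h \<le> 1/4"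
  shows "emeasure circle_uniform {z. circle_dist z p \<le> h} = ennreal (2 * h)"
proof -
  have "emeasure circle_uniform {z. circle_dist z p \<le> h}
      = emeasure lborel {z\<in>{0..<1}. circle_dist z p \<le> h}"
    by (intro emeasure_circle_uniform) measurable
  also have "{z\<in>{0..<1}. circle_dist z p \<le> h} = {z\<in>{0..<1}. int_dist (z - p) \<le> h}"
    using circle_dist_eq_int_dist p by auto
  also have "emeasure lborel \<dots> = emeasure lborel {u\<in>{-1/2..<1/2}. int_dist (p + u - p) \<le> h}"
  proof (intro emeasure_periodic_centred p)
    show "(int_dist (z + 1 - p) \<le> h) = (int_dist (z - p) \<le> h)" for z
      using int_dist_add_int[of "z - p" 1] by (simp add: algebra_simps)
  qed measurable
  also have "{u\<in>{-1/2..<1/2}. int_dist (p + u - p) \<le> h} = {-h..h}"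
    using h by (auto simp: int_dist_eq_abs abs_le_iff)
  also have "emeasure lborel {-h..h} = ennreal (2 * h)"
    using h by simp
  finally show ?thesis .
qed

text \<open>Dilating about \<open>p\<close> by \<open>r\<close> maps the first set into the second: in coordinates centred at \<open>p\<close>,
  \<open>\<bar>r u - v\<bar> \<le> (r - 1) \<bar>u\<bar> + \<bar>u - v\<bar> \<le> (r - 1) g + g\<close> because \<open>\<bar>u\<bar> \<le> h \<le> g\<close>.\<close>

lemma emeasure_circle_dilation:
  assumes p: "p \<in> {0..<1}" and y: "\<And>m. m \<in> F \<Longrightarrow> y m \<in> {0..<1}" and fin: "finite F"
    and near: "\<And>m. m \<in> F \<Longrightarrow> circle_dist (y m) p \<le> 1/4"
    and hg: "\<And>m. m \<in> F \<Longrightarrow> h \<le> g m"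
    and r: "r \<ge> 1" "r * h \<le> 1/4"
  shows "ennreal r * emeasure circle_uniform {z. circle_dist z p \<le> h \<and> (\<forall>m\<in>F. circle_dist z (y m) \<le> g m)}
    \<le> emeasure circle_uniform {z. circle_dist z p \<le> r * h \<and> (\<forall>m\<in>F. circle_dist z (y m) \<le> r * g m)}"
proof -
  \<comment> \<open>\<open>v m\<close> is the representative of \<open>y m - p\<close> modulo 1
    closest to 0. As both points lie in one fundamental domain, the shift is -1, 0 or 1.\<close>
  have "\<exists>v j. v = y m - p + of_int j \<and> \<bar>v\<bar> \<le> 1/4" if "m \<in> F" for m
  proof -
    have "\<bar>y m - p\<bar> \<le> 1/4 \<or> 1 - \<bar>y m - p\<bar> \<le> 1/4"
      using near[OF that] unfolding circle_dist_def min_le_iff_disj .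
    then have "\<bar>y m - p + of_int 0\<bar> \<le> 1/4 \<or> \<bar>y m - p + of_int 1\<bar> \<le> 1/4 \<or> \<bar>y m - p + of_int (-1)\<bar> \<le> 1/4"
      using p y[OF that] unfolding atLeastLessThan_iff of_int_0 of_int_1 of_int_minus by linarith
    then show ?thesis by blast
  qed
  then obtain v j where v: "\<And>m. m \<in> F \<Longrightarrow> v m = y m - p + of_int (j m)"
    and v4: "\<And>m. m \<in> F \<Longrightarrow> \<bar>v m\<bar> \<le> 1/4"
    by metis
  define S where "S a b = {u. \<bar>u\<bar> \<le> a \<and> (\<forall>m\<in>F. \<bar>u - v m\<bar> \<le> b m)}" for a :: real and b
  have S_borel [measurable]: "S a b \<in> sets borel" for a b
    unfolding S_def using fin by measurable
  \<comment> \<open>If \<open>a <= 1/4\<close>, then \<open>u\<close> and \<open>v m\<close> both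
    have modulus at most 1/4, so they differ by at most 1/2 and the circle distance is the Euclidean
    one. Hence no bound on the radii \<open>b m\<close> is needed.\<close>
  have eq: "emeasure circle_uniform {z. circle_dist z p \<le> a \<and> (\<forall>m\<in>F. circle_dist z (y m) \<le> b m)}
      = emeasure lborel (S a b)" if a: "a \<le> 1/4" for a b
  proof -
    have "emeasure circle_uniform {z. circle_dist z p \<le> a \<and> (\<forall>m\<in>F. circle_dist z (y m) \<le> b m)}
      = emeasure lborel {z\<in>{0..<1}. circle_dist z p \<le> a \<and> (\<forall>m\<in>F. circle_dist z (y m) \<le> b m)}"
      using fin by (intro emeasure_circle_uniform) measurable
    also have "{z\<in>{0..<1}. circle_dist z p \<le> a \<and> (\<forall>m\<in>F. circle_dist z (y m) \<le> b m)}
      = {z\<in>{0..<1}. int_dist (z - p) \<le> a \<and> (\<forall>m\<in>F. int_dist (z - y m) \<le> b m)}"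
      using circle_dist_eq_int_dist p y by auto
    also have "emeasure lborel \<dots> = emeasure lborel {u\<in>{-1/2..<1/2}.
        int_dist (p + u - p) \<le> a \<and> (\<forall>m\<in>F. int_dist (p + u - y m) \<le> b m)}"
    proof (intro emeasure_periodic_centred p)
      have "int_dist (z + 1 - q) = int_dist (z - q)" for z q
        using int_dist_add_int[of "z - q" 1] by (simp add: algebra_simps)
      then show "(int_dist (z + 1 - p) \<le> a \<and> (\<forall>m\<in>F. int_dist (z + 1 - y m) \<le> b m))
        = (int_dist (z - p) \<le> a \<and> (\<forall>m\<in>F. int_dist (z - y m) \<le> b m))" for z
        by simp
    qed (use fin in measurable)
    also have "{u\<in>{-1/2..<1/2}. int_dist (p + u - p) \<le> a \<and> (\<forall>m\<in>F. int_dist (p + u - y m) \<le> b m)} = S a b"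
    proof -
      have "int_dist (p + u - y m) = \<bar>u - v m\<bar>" if "\<bar>u\<bar> \<le> 1/4" "m \<in> F" for u m
      proof -
        have "p + u - y m = (u - v m) + of_int (j m)"
          using v[OF that(2)] by simp
        then have "int_dist (p + u - y m) = int_dist (u - v m)"
          by (simp only: int_dist_add_int)
        moreover have "\<bar>u - v m\<bar> \<le> 1/2"
          using that(1) v4[OF that(2)] by linarith
        ultimately show ?thesis
          by (simp add: int_dist_eq_abs)
      qed
      moreover have "int_dist (p + u - p) = \<bar>u\<bar>" if "u \<in> {-1/2..<1/2}" for u
        using that by (auto intro!: int_dist_eq_abs)
      ultimately show ?thesis
        using a unfolding S_def by (auto simp: abs_le_iff)
    qed
    finally show ?thesis .
  qed
  have h: "h \<le> 1/4"
  proof (cases "h \<ge> 0")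
    case True
    then have "h \<le> r * h" using r by (simp add: mult_le_cancel_right1)
    then show ?thesis using r by simp
  qed simp
  have scaled: "r * u \<in> S (r * h) (\<lambda>m. r * g m)" if "u \<in> S h g" for u
  proof -
    have "\<bar>r * u - v m\<bar> \<le> r * g m" if m: "m \<in> F" for m
    proof -
      have u: "\<bar>u\<bar> \<le> g m" "\<bar>u - v m\<bar> \<le> g m"
        using \<open>u \<in> S h g\<close> m hg[OF m] unfolding S_def by auto
      have "r * u - v m = (r - 1) * u + (u - v m)"
        by (simp add: algebra_simps)
      also have "\<bar>\<dots>\<bar> \<le> (r - 1) * \<bar>u\<bar> + \<bar>u - v m\<bar>"
        using r abs_triangle_ineq[of "(r - 1) * u" "u - v m"] by (simp add: abs_mult)
      also have "\<dots> \<le> (r - 1) * g m + g m"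
        using u r by (intro add_mono mult_left_mono) auto
      finally show ?thesis by (simp add: algebra_simps)
    qed
    moreover have "\<bar>r * u\<bar> \<le> r * h"
      using that r unfolding S_def by (simp add: abs_mult)
    ultimately show ?thesis unfolding S_def by auto
  qed
  have "ennreal r * emeasure lborel (S h g) = ennreal r * (\<integral>\<^sup>+u. indicator (S h g) u \<partial>lborel)"
    by simp
  \<comment> \<open>By \<open>scaled\<close>, \<open>u\<close> in the small set forces
    \<open>r * u\<close> into the large one. The substitution by \<open>r * u\<close> then absorbs
    the factor \<open>r\<close>.\<close>
  also have "\<dots> \<le> ennreal r * (\<integral>\<^sup>+u. indicator (S (r * h) (\<lambda>m. r * g m)) (0 + r * u) \<partial>lborel)"
    using scaled by (intro mult_left_mono nn_integral_mono) (auto simp: indicator_def)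
  also have "\<dots> = (\<integral>\<^sup>+u. indicator (S (r * h) (\<lambda>m. r * g m)) u \<partial>lborel)"
    using r nn_integral_real_affine[of "indicator (S (r * h) (\<lambda>m. r * g m))" r 0] by simp
  also have "\<dots> = emeasure lborel (S (r * h) (\<lambda>m. r * g m))"
    by simp
  finally show ?thesis
    using eq[OF h] eq[OF r(2)] by simp
qed

section \<open>Adjacency on the torus\<close>

lemma prob_space_circle_uniform: "prob_space circle_uniform"
  by (rule prob_space_uniform_measure) auto

lemma prob_space_torus_uniform: "prob_space (torus_uniform d)"
  unfolding torus_uniform_def by (intro prob_space_PiM prob_space_circle_uniform)

lemma sets_torus_uniform [measurable_cong]:
  "sets (torus_uniform d) = sets (Pi\<^sub>M {..<d} (\<lambda>_. borel))"
  unfolding torus_uniform_def by (intro sets_PiM_cong) auto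

lemma space_torus_uniform: "space (torus_uniform d) = Pi\<^sub>E {..<d} (\<lambda>_. UNIV)"
  by (simp add: torus_uniform_def space_PiM)

lemma torus_box_eq_PiE: "{z\<in>space (torus_uniform d). \<forall>j<d. z j \<in> A j} = Pi\<^sub>E {..<d} A"
  by (auto simp: space_torus_uniform PiE_def Pi_def extensional_def)

text \<open>In the maximum metric a ball is a product of circle balls, so volumes factor over the
  coordinates and the geometry becomes one-dimensional. \<open>d >= 1\<close> keeps the maximum from
  ranging over the empty set.\<close>

lemma torus_dist_le_iff:
  "d \<ge> 1 \<Longrightarrow> torus_dist d p q \<le> t \<longleftrightarrow> (\<forall>j<d. circle_dist (p j) (q j) \<le> t)"
  unfolding torus_dist_def by (subst Max_le_iff) (auto simp: lessThan_empty_iff)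

lemma torus_dist_commute: "torus_dist d p q = torus_dist d q p"
  unfolding torus_dist_def by (simp add: circle_dist_commute)

lemma threshold_commute: "threshold lam n d a b = threshold lam n d b a"
  by (simp add: threshold_def mult.commute)

lemma adjacent_commute: "adjacent lam n d w x u v \<longleftrightarrow> adjacent lam n d w x v u"
  unfolding adjacent_def by (metis torus_dist_commute threshold_commute)

lemma is_clique_insert:
  assumes "i \<notin> V"
  shows "is_clique lam n d w x (insert i V) \<longleftrightarrow>
    is_clique lam n d w x V \<and> (\<forall>m\<in>V. adjacent lam n d w x i m)"
proof
  assume "is_clique lam n d w x V \<and> (\<forall>m\<in>V. adjacent lam n d w x i m)"
  then show "is_clique lam n d w x (insert i V)"
    unfolding is_clique_def using adjacent_commute by blast
qed (use assms in \<open>auto simp: is_clique_def\<close>)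

section \<open>Measurability of adjacency, cliques and stars\<close>

lemma pred_torus_dist_le:
  assumes d: "d \<ge> 1" and [measurable]: "f \<in> M \<rightarrow>\<^sub>M torus_uniform d" "g \<in> M \<rightarrow>\<^sub>M torus_uniform d"
    "t \<in> borel_measurable M"
  shows "Measurable.pred M (\<lambda>\<omega>. torus_dist d (f \<omega>) (g \<omega>) \<le> t \<omega>)"
proof -
  have [measurable]: "(\<lambda>\<omega>. h \<omega> j) \<in> borel_measurable M"
    if "h \<in> M \<rightarrow>\<^sub>M torus_uniform d" "j < d" for h j
  proof -
    have "(\<lambda>z. z j) \<in> borel_measurable (torus_uniform d)"
      using that(2) unfolding measurable_cong_sets[OF sets_torus_uniform refl]
      by (intro measurable_component_singleton) auto
    then show ?thesis
      using that(1) by (rule measurable_compose[rotated])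
  qed
  show ?thesis
    unfolding torus_dist_le_iff[OF d] by measurable
qed

lemma pred_adjacent:
  assumes "d \<ge> 1"
    and [measurable]: "(\<lambda>\<omega>. W \<omega> u) \<in> borel_measurable M" "(\<lambda>\<omega>. W \<omega> v) \<in> borel_measurable M"
      "(\<lambda>\<omega>. X \<omega> u) \<in> M \<rightarrow>\<^sub>M torus_uniform d" "(\<lambda>\<omega>. X \<omega> v) \<in> M \<rightarrow>\<^sub>M torus_uniform d"
  shows "Measurable.pred M (\<lambda>\<omega>. adjacent lam n d (W \<omega>) (X \<omega>) u v)"
proof -
  have "Measurable.pred M (\<lambda>\<omega>. torus_dist d (X \<omega> u) (X \<omega> v) \<le> threshold lam n d (W \<omega> u) (W \<omega> v))"
    by (intro pred_torus_dist_le assms) (unfold threshold_def, measurable)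
  then show ?thesis
    unfolding adjacent_def by measurable
qed

lemma pred_is_clique:
  assumes "d \<ge> 1" "finite V" "\<And>u. u \<in> V \<Longrightarrow> (\<lambda>\<omega>. W \<omega> u) \<in> borel_measurable M"
    "\<And>u. u \<in> V \<Longrightarrow> (\<lambda>\<omega>. X \<omega> u) \<in> M \<rightarrow>\<^sub>M torus_uniform d"
  shows "Measurable.pred M (\<lambda>\<omega>. is_clique lam n d (W \<omega>) (X \<omega>) V)"
  unfolding is_clique_def using assms
  by (intro pred_intros_finite pred_intros_imp' pred_adjacent) auto

lemma pred_is_star:
  assumes "d \<ge> 1" "k \<ge> 1" "\<And>i. i \<in> {1..k} \<Longrightarrow> (\<lambda>\<omega>. W \<omega> (v i)) \<in> borel_measurable M"
    "\<And>i. i \<in> {1..k} \<Longrightarrow> (\<lambda>\<omega>. X \<omega> (v i)) \<in> M \<rightarrow>\<^sub>M torus_uniform d"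
  shows "Measurable.pred M (\<lambda>\<omega>. is_star lam n d c k (W \<omega>) (X \<omega>) v)"
proof -
  have [measurable]: "(\<lambda>\<omega>. W \<omega> (v 1)) \<in> borel_measurable M" "(\<lambda>\<omega>. W \<omega> (v k)) \<in> borel_measurable M"
    using assms by auto
  have "Measurable.pred M (\<lambda>\<omega>. \<forall>i\<in>{2..k}. adjacent lam n d (W \<omega>) (X \<omega>) (v 1) (v i))"
    using assms by (intro pred_intros_finite pred_adjacent) auto
  then show ?thesis
    unfolding is_star_def by measurable
qed

section \<open>Fibres over the position of one vertex, and volumes of boxes\<close>

text \<open>Fubini with coordinate \<open>i\<close> integrated first. The second conclusion,
  measurability of the fibre volume, allows constants to be pulled out of the outer
  integral.\<close>

lemma emeasure_PiM_fibre:
  assumes T: "prob_space T" and I: "finite I" "i \<notin> I"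
    and Q: "Measurable.pred (Pi\<^sub>M (insert i I) (\<lambda>_. T)) Q"
  shows "emeasure (Pi\<^sub>M (insert i I) (\<lambda>_. T)) {x\<in>space (Pi\<^sub>M (insert i I) (\<lambda>_. T)). Q x}
     = (\<integral>\<^sup>+x. emeasure T {z\<in>space T. Q (x(i := z))} \<partial>Pi\<^sub>M I (\<lambda>_. T))"
    and "(\<lambda>x. emeasure T {z\<in>space T. Q (x(i := z))}) \<in> borel_measurable (Pi\<^sub>M I (\<lambda>_. T))"
proof -
  interpret T: prob_space T by fact
  interpret product_sigma_finite "\<lambda>_. T" ..
  let ?P = "Pi\<^sub>M (insert i I) (\<lambda>_. T)"
  have S: "{x\<in>space ?P. Q x} \<in> sets ?P"
    using Q by measurable
  have "emeasure ?P {x\<in>space ?P. Q x} = (\<integral>\<^sup>+x. indicator {x\<in>space ?P. Q x} x \<partial>?P)"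
    using S by simp
  also have "\<dots> = (\<integral>\<^sup>+x. (\<integral>\<^sup>+z. indicator {x\<in>space ?P. Q x} (x(i := z)) \<partial>T) \<partial>Pi\<^sub>M I (\<lambda>_. T))"
    using S by (intro product_nn_integral_insert I) simp
  also have "\<dots> = (\<integral>\<^sup>+x. emeasure T {z\<in>space T. Q (x(i := z))} \<partial>Pi\<^sub>M I (\<lambda>_. T))"
  proof (intro nn_integral_cong)
    fix x assume x: "x \<in> space (Pi\<^sub>M I (\<lambda>_. T))"
    have upd: "(\<lambda>z. x(i := z)) \<in> T \<rightarrow>\<^sub>M ?P"
      using x by (intro measurable_component_update) (use I in auto)
    have "{z\<in>space T. Q (x(i := z))} \<in> sets T"
      using measurable_compose[OF upd Q] by simp
    then have "emeasure T {z\<in>space T. Q (x(i := z))}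
        = (\<integral>\<^sup>+z. indicator {z\<in>space T. Q (x(i := z))} z \<partial>T)"
      by simp
    also have "\<dots> = (\<integral>\<^sup>+z. indicator {x\<in>space ?P. Q x} (x(i := z)) \<partial>T)"
      using measurable_space[OF upd] by (intro nn_integral_cong) (auto simp: indicator_def)
    finally show "(\<integral>\<^sup>+z. indicator {x\<in>space ?P. Q x} (x(i := z)) \<partial>T)
        = emeasure T {z\<in>space T. Q (x(i := z))}" ..
  qed
  finally show "emeasure ?P {x\<in>space ?P. Q x}
     = (\<integral>\<^sup>+x. emeasure T {z\<in>space T. Q (x(i := z))} \<partial>Pi\<^sub>M I (\<lambda>_. T))" .
  have [measurable]: "Measurable.pred (Pi\<^sub>M I (\<lambda>_. T) \<Otimes>\<^sub>M T) (\<lambda>p. Q ((fst p)(i := snd p)))"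
    using measurable_compose[OF measurable_add_dim[of i I "\<lambda>_. T"] Q] by (simp add: case_prod_unfold)
  show "(\<lambda>x. emeasure T {z\<in>space T. Q (x(i := z))}) \<in> borel_measurable (Pi\<^sub>M I (\<lambda>_. T))"
  proof (rule T.measurable_emeasure)
    have "{p\<in>space (Pi\<^sub>M I (\<lambda>_. T) \<Otimes>\<^sub>M T). snd p \<in> {z\<in>space T. Q ((fst p)(i := z))}}
        = {p\<in>space (Pi\<^sub>M I (\<lambda>_. T) \<Otimes>\<^sub>M T). Q ((fst p)(i := snd p))}"
      by (auto simp: space_pair_measure)
    then show "{p\<in>space (Pi\<^sub>M I (\<lambda>_. T) \<Otimes>\<^sub>M T). snd p \<in> {z\<in>space T. Q ((fst p)(i := z))}}
        \<in> sets (Pi\<^sub>M I (\<lambda>_. T) \<Otimes>\<^sub>M T)"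
      by simp
  qed auto
qed

lemma emeasure_torus_box:
  assumes "\<And>j. j < d \<Longrightarrow> A j \<in> sets borel"
  shows "emeasure (torus_uniform d) (Pi\<^sub>E {..<d} A) = (\<Prod>j<d. emeasure circle_uniform (A j))"
proof -
  interpret circle: prob_space circle_uniform by (rule prob_space_circle_uniform)
  interpret product_sigma_finite "\<lambda>_. circle_uniform" ..
  show ?thesis
    unfolding torus_uniform_def using assms by (intro emeasure_PiM) auto
qed

text \<open>The space of \<open>torus_uniform d\<close> contains every extensional real function on
  the coordinates, so the range in which \<open>circle_dist\<close> is meaningful is guaranteed only
  almost everywhere.\<close>

lemma AE_torus_positions:
  assumes "finite I"
  shows "AE x in Pi\<^sub>M I (\<lambda>_. torus_uniform d). \<forall>m\<in>I. \<forall>j<d. x m j \<in> {0..<1}"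
proof -
  have "AE y in circle_uniform. y \<in> {0..<1}"
    by (rule AE_uniform_measureI) auto
  then have "AE z in torus_uniform d. \<forall>j\<in>{..<d}. z j \<in> {0..<1}"
    unfolding torus_uniform_def
    by (intro AE_finite_allI ballI AE_PiM_component prob_space_circle_uniform) auto
  then have "AE x in Pi\<^sub>M I (\<lambda>_. torus_uniform d). \<forall>m\<in>I. \<forall>j\<in>{..<d}. x m j \<in> {0..<1}"
    using assms
    by (intro AE_finite_allI ballI AE_PiM_component[where P = "\<lambda>z. \<forall>j\<in>{..<d}. z j \<in> {0..<1}"]
        prob_space_torus_uniform) auto
  then show ?thesis by (simp add: Ball_def)
qed

section \<open>Scaling and smallness of the thresholds\<close>

lemma threshold_mono:
  assumes "lam > 0" "0 \<le> a" "a \<le> a'" "0 \<le> b" "b \<le> b'"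
  shows "threshold lam n d a b \<le> threshold lam n d a' b'"
  unfolding threshold_def girg_tau_def using assms
  by (intro powr_mono2 divide_right_mono mult_mono) auto

text \<open>The threshold is homogeneous of degree \<open>1/d\<close> in each weight. This is the
  source of the dilation factor \<open>r\<close>.\<close>

lemma threshold_scale:
  assumes "lam > 0" "0 \<le> a" "0 < s" "0 < s'"
  shows "threshold lam n d a s' = (s' / s) powr (1 / real d) * threshold lam n d a s"
proof -
  have "a * s' / (girg_tau lam d * real n) = (s' / s) * (a * s / (girg_tau lam d * real n))"
    using assms by simp
  then show ?thesis
    unfolding threshold_def using assms by (simp only: powr_mult)
qed

text \<open>As \<open>w m <= c ^ d * w 1\<close>, homogeneity bounds the threshold by
  \<open>c\<close> times that of two vertices of weight \<open>w 1\<close>. Since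
  \<open>c >= 1\<close>, this is at most \<open>c\<^sup>2\<close> times it, which admissibility
  bounds by 1/4.\<close>

lemma admissible_threshold_le:
  assumes lam: "lam > 0" and w0: "w\<^sub>0 > 0" and d: "d \<ge> 1" and c: "c \<ge> 1"
    and adm: "admissible lam n w\<^sub>0 d c k w" and m: "m \<in> {1..k}"
  shows "threshold lam n d (w 1) (w m) \<le> 1/4"
proof -
  let ?q = "((w 1)\<^sup>2 / (girg_tau lam d * real n)) powr (1 / real d)"
  have w1: "w 1 > 0" and mono: "mono_on {1..k} w" and wk: "w k \<le> c ^ d * w 1"
    and small: "c\<^sup>2 * ?q \<le> 1/4"
    using adm w0 by (auto simp: admissible_def)
  have "w 1 \<le> w m" "w m \<le> w k"
    using m by (auto intro!: mono_onD[OF mono])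
  then have "threshold lam n d (w 1) (w m) \<le> threshold lam n d (w 1) (c ^ d * w 1)"
    using lam w1 wk by (intro threshold_mono) auto
  also have "\<dots> = (c ^ d) powr (1 / real d) * threshold lam n d (w 1) (w 1)"
    using threshold_scale[of lam "w 1" "w 1" "c ^ d * w 1"] lam w1 c by simp
  also have "threshold lam n d (w 1) (w 1) = ?q"
    by (simp add: threshold_def power2_eq_square)
  also have "(c ^ d) powr (1 / real d) = c"
    using c d by (simp add: powr_realpow[symmetric] powr_powr)
  also have "c * ?q \<le> c\<^sup>2 * ?q"
    using c by (intro mult_right_mono) (auto simp: power2_eq_square)
  finally show ?thesis using small by simp
qed

section \<open>Monotonicity\<close>

text \<open>With the other positions fixed, the region for vertex \<open>i\<close> is empty or a
  box. \<open>emeasure_circle_dilation\<close> makes each of its \<open>d\<close> sides grow by at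
  least the factor \<open>r\<close>, which gives \<open>r ^ d\<close> in total.\<close>

lemma emeasure_clique_fibre_le:
  fixes x :: "nat \<Rightarrow> nat \<Rightarrow> real"
  assumes lam: "lam > 0" and w0: "w\<^sub>0 > 0" and d: "d \<ge> 1" and c: "c \<ge> 1" and i: "i \<in> {2..k}"
    and adm: "admissible lam n w\<^sub>0 d c k (w(i := s))" and adm': "admissible lam n w\<^sub>0 d c k (w(i := s'))"
    and le: "s \<le> s'" and x: "\<And>m j. m \<in> {1..k} - {i} \<Longrightarrow> j < d \<Longrightarrow> x m j \<in> {0..<1}"
  shows "ennreal ((s' / s) powr (1 / real d)) ^ d *
      emeasure (torus_uniform d) {z\<in>space (torus_uniform d). is_clique lam n d (w(i := s)) (x(i := z)) {1..k}}
    \<le> emeasure (torus_uniform d) {z\<in>space (torus_uniform d). is_clique lam n d (w(i := s')) (x(i := z)) {1..k}}"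
proof -
  let ?T = "torus_uniform d" and ?I = "{1..k} - {i}" and ?t = "threshold lam n d"
  define r where "r = (s' / s) powr (1 / real d)"
  define F where "F = ?I - {1}"
  have I: "?I = insert 1 F" "{1..k} = insert i ?I" using i by (auto simp: F_def)
  have w1: "0 < w 1" and mono: "mono_on {1..k} (w(i := s))"
    using adm w0 i by (auto simp: admissible_def)
  have w1_le: "w 1 \<le> (w(i := s)) m" if "m \<in> {1..k}" for m
    using mono_onD[OF mono, of 1 m] that i by auto
  have s: "0 < s" "w 1 \<le> s" using w1_le[of i] i w1 by auto
  have r1: "r \<ge> 1" unfolding r_def using s le by (simp add: ge_one_powr_ge_zero)
  have w_pos: "0 < w m" "w 1 \<le> w m" if "m \<in> ?I" for m
    using w1_le[of m] that w1 by auto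
  have scale: "?t a s' = r * ?t a s" if "0 \<le> a" for a
    unfolding r_def using lam that s le by (intro threshold_scale) auto
  \<comment> \<open>\<open>A u j\<close> is the set of \<open>j\<close>-th coordinates permitted to
    vertex \<open>i\<close> at weight \<open>u\<close>. Vertex 1 is kept out of \<open>F\<close>
    because it is the centre of the dilation.\<close>
  define A where "A u j = {y. circle_dist y (x 1 j) \<le> ?t (w 1) u \<and>
      (\<forall>m\<in>F. circle_dist y (x m j) \<le> ?t (w m) u)}" for u j
  have A_borel: "A u j \<in> sets borel" for u j
    unfolding A_def F_def by measurable
  have clique: "is_clique lam n d (w(i := u)) (x(i := z)) {1..k} \<longleftrightarrow>
      is_clique lam n d w x ?I \<and> (\<forall>m\<in>?I. torus_dist d z (x m) \<le> ?t (w m) u)" for u z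
  proof -
    have "is_clique lam n d (w(i := u)) (x(i := z)) {1..k} \<longleftrightarrow>
      is_clique lam n d (w(i := u)) (x(i := z)) ?I \<and>
      (\<forall>m\<in>?I. adjacent lam n d (w(i := u)) (x(i := z)) i m)"
      using is_clique_insert[of i ?I lam n d "w(i := u)" "x(i := z)"] I(2) by simp
    moreover have "is_clique lam n d (w(i := u)) (x(i := z)) ?I \<longleftrightarrow> is_clique lam n d w x ?I"
      unfolding is_clique_def adjacent_def by auto
    moreover have "adjacent lam n d (w(i := u)) (x(i := z)) i m \<longleftrightarrow> torus_dist d z (x m) \<le> ?t (w m) u"
      if "m \<in> ?I" for m
      using that threshold_commute[of lam n d u "w m"] by (auto simp: adjacent_def)
    ultimately show ?thesis by blast
  qed
  show ?thesis
  \<comment> \<open>This condition involves neither the position nor the weight of vertex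
    \<open>i\<close>. If it fails, both fibres are empty.\<close>
  proof (cases "is_clique lam n d w x ?I")
    case False
    then show ?thesis unfolding clique by simp
  next
    case True
    have fibre: "{z\<in>space ?T. is_clique lam n d (w(i := u)) (x(i := z)) {1..k}} = Pi\<^sub>E {..<d} (A u)" for u
    proof -
      have "is_clique lam n d (w(i := u)) (x(i := z)) {1..k} \<longleftrightarrow> (\<forall>j<d. z j \<in> A u j)" for z
        using True unfolding clique torus_dist_le_iff[OF d] A_def I(1) by auto
      then show ?thesis by (simp add: torus_box_eq_PiE)
    qed
    \<comment> \<open>The clique on the remaining vertices itself places each of them within 1/4 of
      vertex 1.\<close>
    have near: "circle_dist (x m j) (x 1 j) \<le> 1/4" if m: "m \<in> F" and j: "j < d" for m j
    proof -
      have "adjacent lam n d w x m 1"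
        using True m i unfolding is_clique_def F_def by auto
      then have "circle_dist (x m j) (x 1 j) \<le> ?t (w 1) (w m)"
        using j threshold_commute unfolding adjacent_def torus_dist_le_iff[OF d] by metis
      also have "\<dots> \<le> 1/4"
        using admissible_threshold_le[OF lam w0 d c adm, of m] m i by (auto simp: F_def)
      finally show ?thesis .
    qed
    \<comment> \<open>This is where admissibility at the larger weight enters: even the dilated ball
      about vertex 1 does not wrap around the circle.\<close>
    have small: "r * ?t (w 1) s \<le> 1/4"
      using admissible_threshold_le[OF lam w0 d c adm', of i] i scale[of "w 1"] w1 by auto
    have one: "ennreal r * emeasure circle_uniform (A s j) \<le> emeasure circle_uniform (A s' j)"
      if j: "j < d" for j
    proof -
      have "ennreal r * emeasure circle_uniform (A s j) \<le> emeasure circle_uniform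
          {y. circle_dist y (x 1 j) \<le> r * ?t (w 1) s \<and> (\<forall>m\<in>F. circle_dist y (x m j) \<le> r * ?t (w m) s)}"
        unfolding A_def
      proof (rule emeasure_circle_dilation)
        show "x 1 j \<in> {0..<1}" using x[of 1 j] i j by auto
        show "x m j \<in> {0..<1}" if "m \<in> F" for m using x[of m j] that j by (auto simp: F_def)
        \<comment> \<open>Vertex 1 has the smallest weight, so its ball is the tightest constraint
          on vertex \<open>i\<close>. The dilation inequality relies on this.\<close>
        show "?t (w 1) s \<le> ?t (w m) s" if "m \<in> F" for m
          using w_pos[of m] that s w1 lam by (intro threshold_mono) (auto simp: F_def)
      qed (use near j r1 small in \<open>auto simp: F_def\<close>)
      also have "{y. circle_dist y (x 1 j) \<le> r * ?t (w 1) s \<and> (\<forall>m\<in>F. circle_dist y (x m j) \<le> r * ?t (w m) s)}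
          = A s' j"
        unfolding A_def using scale w1 w_pos by (auto simp: F_def less_imp_le)
      finally show ?thesis .
    qed
    have "ennreal r ^ d * emeasure ?T (Pi\<^sub>E {..<d} (A s))
        = (\<Prod>j<d. ennreal r * emeasure circle_uniform (A s j))"
      by (simp add: emeasure_torus_box A_borel prod.distrib)
    also have "\<dots> \<le> (\<Prod>j<d. emeasure circle_uniform (A s' j))"
      using one by (intro prod_mono_ennreal) auto
    also have "\<dots> = emeasure ?T (Pi\<^sub>E {..<d} (A s'))"
      by (simp add: emeasure_torus_box A_borel)
    finally show ?thesis unfolding fibre r_def .
  qed
qed

text \<open>Only the edge from vertex 1 to \<open>i\<close> depends on the position of
  \<open>i\<close>, and it confines that position to a cube about vertex 1. The cube does not wrap
  around, so each side is exactly twice the threshold.\<close>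

lemma emeasure_star_fibre:
  fixes x :: "nat \<Rightarrow> nat \<Rightarrow> real"
  assumes lam: "lam > 0" and w0: "w\<^sub>0 > 0" and d: "d \<ge> 1" and c: "c \<ge> 1" and i: "i \<in> {2..k}"
    and adm: "admissible lam n w\<^sub>0 d c k (w(i := s))"
    and x: "\<And>j. j < d \<Longrightarrow> x 1 j \<in> {0..<1}"
  shows "emeasure (torus_uniform d)
      {z\<in>space (torus_uniform d). is_star lam n d c k (w(i := s)) (x(i := z)) (\<lambda>i. i)}
    = (if \<forall>m\<in>{2..k}-{i}. adjacent lam n d w x 1 m then ennreal (2 * threshold lam n d (w 1) s) ^ d else 0)"
proof -
  let ?T = "torus_uniform d" and ?t = "threshold lam n d"
  let ?ok = "\<forall>m\<in>{2..k}-{i}. adjacent lam n d w x 1 m"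
  have weight: "(w(i := s)) k \<le> c ^ d * (w(i := s)) 1"
    using adm by (auto simp: admissible_def)
  have "is_star lam n d c k (w(i := s)) (x(i := z)) (\<lambda>i. i) \<longleftrightarrow>
      ?ok \<and> torus_dist d z (x 1) \<le> ?t (w 1) s" for z
  proof -
    have "{2..k} = insert i ({2..k} - {i})" using i by auto
    then have "(\<forall>m\<in>{2..k}. adjacent lam n d (w(i := s)) (x(i := z)) 1 m) \<longleftrightarrow>
        adjacent lam n d (w(i := s)) (x(i := z)) 1 i \<and>
        (\<forall>m\<in>{2..k}-{i}. adjacent lam n d (w(i := s)) (x(i := z)) 1 m)"
      by blast
    also have "adjacent lam n d (w(i := s)) (x(i := z)) 1 i \<longleftrightarrow> torus_dist d z (x 1) \<le> ?t (w 1) s"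
      using i torus_dist_commute[of d z "x 1"] by (auto simp: adjacent_def)
    also have "(\<forall>m\<in>{2..k}-{i}. adjacent lam n d (w(i := s)) (x(i := z)) 1 m) \<longleftrightarrow> ?ok"
      using i by (auto simp: adjacent_def)
    finally show ?thesis using weight unfolding is_star_def by blast
  qed
  then have "{z\<in>space ?T. is_star lam n d c k (w(i := s)) (x(i := z)) (\<lambda>i. i)}
      = (if ?ok then {z\<in>space ?T. \<forall>j<d. z j \<in> {y. circle_dist y (x 1 j) \<le> ?t (w 1) s}} else {})"
    unfolding torus_dist_le_iff[OF d] by simp
  also have "{z\<in>space ?T. \<forall>j<d. z j \<in> {y. circle_dist y (x 1 j) \<le> ?t (w 1) s}}
      = Pi\<^sub>E {..<d} (\<lambda>j. {y. circle_dist y (x 1 j) \<le> ?t (w 1) s})"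
    by (rule torus_box_eq_PiE)
  finally have "{z\<in>space ?T. is_star lam n d c k (w(i := s)) (x(i := z)) (\<lambda>i. i)}
      = (if ?ok then Pi\<^sub>E {..<d} (\<lambda>j. {y. circle_dist y (x 1 j) \<le> ?t (w 1) s}) else {})" .
  moreover have "emeasure ?T (Pi\<^sub>E {..<d} (\<lambda>j. {y. circle_dist y (x 1 j) \<le> ?t (w 1) s}))
      = (\<Prod>j<d. emeasure circle_uniform {y. circle_dist y (x 1 j) \<le> ?t (w 1) s})"
    by (intro emeasure_torus_box) measurable
  moreover have "emeasure circle_uniform {y. circle_dist y (x 1 j) \<le> ?t (w 1) s} = ennreal (2 * ?t (w 1) s)"
    if "j < d" for j
    using admissible_threshold_le[OF lam w0 d c adm, of i] i x[OF that]
    by (intro emeasure_circle_ball) (auto simp: threshold_def)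
  ultimately show ?thesis by simp
qed

lemma clique_prob_mono:
  assumes lam: "lam > 0" and w0: "w\<^sub>0 > 0" and d: "d \<ge> 1" and c: "c \<ge> 1" and i: "i \<in> {2..k}"
    and adm: "admissible lam n w\<^sub>0 d c k (w(i := s))" and adm': "admissible lam n w\<^sub>0 d c k (w(i := s'))"
    and le: "s \<le> s'"
  shows "clique_prob lam n d c k (w(i := s)) \<le> clique_prob lam n d c k (w(i := s'))"
proof -
  let ?T = "torus_uniform d" and ?I = "{1..k} - {i}"
  let ?P = "Pi\<^sub>M {1..k} (\<lambda>_. ?T)"
  interpret T: prob_space ?T by (rule prob_space_torus_uniform)
  interpret P: prob_space ?P by (intro prob_space_PiM prob_space_torus_uniform)
  define r where "r = (s' / s) powr (1 / real d)"
  have I: "insert i ?I = {1..k}" "i \<notin> ?I" "finite ?I" using i by auto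
  have w1: "0 < w 1" and mono: "mono_on {1..k} (w(i := s))"
    using adm w0 i by (auto simp: admissible_def)
  have s: "0 < s" using mono_onD[OF mono, of 1 i] i w1 by auto
  define C where "C u = {x\<in>space ?P. is_clique lam n d (w(i := u)) x {1..k}}" for u
  define S where "S u = {x\<in>space ?P. is_star lam n d c k (w(i := u)) x (\<lambda>i. i)}" for u
  have pos: "(\<lambda>x. x m) \<in> ?P \<rightarrow>\<^sub>M ?T" if "m \<in> {1..k}" for m
    using that by measurable
  have C_pred: "Measurable.pred ?P (\<lambda>x. is_clique lam n d (w(i := u)) x {1..k})" for u
    using pos by (intro pred_is_clique d) auto
  have S_pred: "Measurable.pred ?P (\<lambda>x. is_star lam n d c k (w(i := u)) x (\<lambda>i. i))" for u
    using pos i by (intro pred_is_star d) auto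
  have C_fibre: "emeasure ?P (C u)
      = (\<integral>\<^sup>+x. emeasure ?T {z\<in>space ?T. is_clique lam n d (w(i := u)) (x(i := z)) {1..k}} \<partial>Pi\<^sub>M ?I (\<lambda>_. ?T))" for u
    using emeasure_PiM_fibre(1)[OF T.prob_space_axioms I(3,2), unfolded I(1), OF C_pred] by (simp add: C_def)
  have C_fibre_meas: "(\<lambda>x. emeasure ?T {z\<in>space ?T. is_clique lam n d (w(i := u)) (x(i := z)) {1..k}})
      \<in> borel_measurable (Pi\<^sub>M ?I (\<lambda>_. ?T))" for u
    using emeasure_PiM_fibre(2)[OF T.prob_space_axioms I(3,2), unfolded I(1), OF C_pred] .
  have S_fibre: "emeasure ?P (S u)
      = (\<integral>\<^sup>+x. emeasure ?T {z\<in>space ?T. is_star lam n d c k (w(i := u)) (x(i := z)) (\<lambda>i. i)} \<partial>Pi\<^sub>M ?I (\<lambda>_. ?T))" for u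
    using emeasure_PiM_fibre(1)[OF T.prob_space_axioms I(3,2), unfolded I(1), OF S_pred] by (simp add: S_def)
  have "ennreal r ^ d * emeasure ?P (C s) = (\<integral>\<^sup>+x. ennreal r ^ d *
      emeasure ?T {z\<in>space ?T. is_clique lam n d (w(i := s)) (x(i := z)) {1..k}} \<partial>Pi\<^sub>M ?I (\<lambda>_. ?T))"
    unfolding C_fibre using C_fibre_meas by (intro nn_integral_cmult[symmetric])
  also have "\<dots> \<le> emeasure ?P (C s')"
    unfolding C_fibre r_def
    by (rule nn_integral_mono_AE, rule AE_mp[OF AE_torus_positions[OF I(3)] AE_I2])
      (use emeasure_clique_fibre_le[OF lam w0 d c i adm adm' le] in blast)
  finally have C_le: "ennreal r ^ d * emeasure ?P (C s) \<le> emeasure ?P (C s')" .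
  have S_fibre_meas: "(\<lambda>x. emeasure ?T {z\<in>space ?T. is_star lam n d c k (w(i := u)) (x(i := z)) (\<lambda>i. i)})
      \<in> borel_measurable (Pi\<^sub>M ?I (\<lambda>_. ?T))" for u
    using emeasure_PiM_fibre(2)[OF T.prob_space_axioms I(3,2), unfolded I(1), OF S_pred] .
  have r: "0 < r" unfolding r_def using s le by auto
  have "threshold lam n d (w 1) s' = r * threshold lam n d (w 1) s"
    unfolding r_def using lam w1 s le by (intro threshold_scale) auto
  then have "ennreal (2 * threshold lam n d (w 1) s') = ennreal r * ennreal (2 * threshold lam n d (w 1) s)"
    using r by (simp add: ennreal_mult[symmetric] threshold_def algebra_simps)
  then have star_scale: "emeasure ?T {z\<in>space ?T. is_star lam n d c k (w(i := s')) (x(i := z)) (\<lambda>i. i)}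
      = ennreal r ^ d * emeasure ?T {z\<in>space ?T. is_star lam n d c k (w(i := s)) (x(i := z)) (\<lambda>i. i)}"
    if "\<forall>m\<in>?I. \<forall>j<d. x m j \<in> {0..<1}" for x
  proof -
    have "x 1 j \<in> {0..<1}" if "j < d" for j
      using \<open>\<forall>m\<in>?I. \<forall>j<d. x m j \<in> {0..<1}\<close> that i by auto
    then have star: "emeasure ?T {z\<in>space ?T. is_star lam n d c k (w(i := u)) (x(i := z)) (\<lambda>i. i)}
        = (if \<forall>m\<in>{2..k}-{i}. adjacent lam n d w x 1 m then ennreal (2 * threshold lam n d (w 1) u) ^ d else 0)"
      if "admissible lam n w\<^sub>0 d c k (w(i := u))" for u
      using emeasure_star_fibre[OF lam w0 d c i that] by blast
    show ?thesis
      unfolding star[OF adm] star[OF adm'] \<open>ennreal (2 * threshold lam n d (w 1) s') = _\<close> by (simp add: power_mult_distrib)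
  qed
  have S_eq: "emeasure ?P (S s') = ennreal r ^ d * emeasure ?P (S s)"
    unfolding S_fibre nn_integral_cmult[OF S_fibre_meas, symmetric]
    by (rule nn_integral_cong_AE, rule AE_mp[OF AE_torus_positions[OF I(3)] AE_I2])
      (use star_scale in blast)
  \<comment> \<open>For admissible weights a clique contains the star, so the numerator is the plain
    clique probability.\<close>
  have prob: "clique_prob lam n d c k (w(i := u)) = measure ?P (C u) / measure ?P (S u)"
    if "admissible lam n w\<^sub>0 d c k (w(i := u))" for u
  proof -
    have "(w(i := u)) k \<le> c ^ d * (w(i := u)) 1"
      using that by (auto simp: admissible_def)
    then have "is_star lam n d c k (w(i := u)) x (\<lambda>i. i)" if "is_clique lam n d (w(i := u)) x {1..k}" for x
      using that unfolding is_star_def is_clique_def by auto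
    then have "{x\<in>space ?P. is_clique lam n d (w(i := u)) x {1..k} \<and> is_star lam n d c k (w(i := u)) x (\<lambda>i. i)} = C u"
      unfolding C_def by blast
    then show ?thesis
      unfolding clique_prob_def cond_prob_def S_def by simp
  qed
  have "r ^ d * measure ?P (C s) \<le> measure ?P (C s')"
    using C_le r unfolding P.emeasure_eq_measure by (simp add: ennreal_power ennreal_mult[symmetric])
  moreover have "measure ?P (S s') = r ^ d * measure ?P (S s)"
    using S_eq r unfolding P.emeasure_eq_measure by (simp add: ennreal_power ennreal_mult[symmetric])
  \<comment> \<open>Expanding by \<open>r ^ d\<close> gives both quotients the same denominator.
    This also holds if that denominator is 0.\<close>
  moreover have "measure ?P (C s) / measure ?P (S s) = (r ^ d * measure ?P (C s)) / (r ^ d * measure ?P (S s))"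
    using r by simp
  ultimately show ?thesis
    unfolding prob[OF adm] prob[OF adm'] using r by (simp only: divide_right_mono mult_nonneg_nonneg zero_le_power less_imp_le measure_nonneg)
qed

section \<open>The conditional probability\<close>

lemma prob_space_weight_law:
  assumes w0: "w\<^sub>0 > 0" and b: "\<beta> > 1"
  shows "prob_space (weight_law \<beta> w\<^sub>0)"
proof -
  have "real_distribution (interval_measure (weight_cdf \<beta> w\<^sub>0))"
  proof (rule real_distribution_interval_measure)
    show "weight_cdf \<beta> w\<^sub>0 x \<le> weight_cdf \<beta> w\<^sub>0 y" if "x \<le> y" for x y
    proof -
      \<comment> \<open>This bound serves the case where \<open>x\<close> lies below the minimal
        weight and \<open>y\<close> does not: the value at \<open>y\<close> must then be
        nonnegative.\<close>
      have "(y / w\<^sub>0) powr (1 - \<beta>) \<le> 1" if "w\<^sub>0 \<le> y"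
        using powr_mono2'[of "1 - \<beta>" 1 "y / w\<^sub>0"] that w0 b by simp
      moreover have "(y / w\<^sub>0) powr (1 - \<beta>) \<le> (x / w\<^sub>0) powr (1 - \<beta>)" if "w\<^sub>0 \<le> x"
        using that \<open>x \<le> y\<close> w0 b by (intro powr_mono2') (auto simp: divide_right_mono)
      ultimately show ?thesis
        using that by (auto simp: weight_cdf_def)
    qed
    show "continuous (at_right a) (weight_cdf \<beta> w\<^sub>0)" for a
    proof (cases "w\<^sub>0 \<le> a")
      case True
      have "((\<lambda>x. 1 - (x / w\<^sub>0) powr (1 - \<beta>)) \<longlongrightarrow> weight_cdf \<beta> w\<^sub>0 a) (at_right a)"
        unfolding weight_cdf_def using True w0 by (auto intro!: tendsto_eq_intros)
      moreover have "\<forall>\<^sub>F x in at_right a. 1 - (x / w\<^sub>0) powr (1 - \<beta>) = weight_cdf \<beta> w\<^sub>0 x"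
        using eventually_at_right_less[of a] by eventually_elim (use True in \<open>auto simp: weight_cdf_def\<close>)
      ultimately show ?thesis
        unfolding continuous_within by (rule Lim_transform_eventually)
    next
      case False
      then have "\<forall>\<^sub>F x in at_right a. x < w\<^sub>0"
        by (intro eventually_at_right_real[THEN eventually_mono, of a w\<^sub>0]) auto
      then have "\<forall>\<^sub>F x in at_right a. 0 = weight_cdf \<beta> w\<^sub>0 x"
        by eventually_elim (auto simp: weight_cdf_def)
      then show ?thesis
        unfolding continuous_within using False
        by (intro Lim_transform_eventually[OF tendsto_const[of 0, THEN tendsto_eq_rhs]])
          (auto simp: weight_cdf_def)
    qed
    have "\<forall>\<^sub>F x in at_bot. x < w\<^sub>0"
      by (rule eventually_gt_at_bot)
    then have "\<forall>\<^sub>F x in at_bot. 0 = weight_cdf \<beta> w\<^sub>0 x"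
      by eventually_elim (auto simp: weight_cdf_def)
    then show "(weight_cdf \<beta> w\<^sub>0 \<longlongrightarrow> 0) at_bot"
      by (rule Lim_transform_eventually[OF tendsto_const])
    have "filterlim (\<lambda>x. x / w\<^sub>0) at_top at_top"
      unfolding divide_inverse using w0
      by (intro filterlim_at_top_mult_tendsto_pos[OF tendsto_const _ filterlim_ident]) auto
    then have "((\<lambda>x. 1 - (x / w\<^sub>0) powr (1 - \<beta>)) \<longlongrightarrow> 1 - 0) at_top"
      using b by (intro tendsto_diff tendsto_const tendsto_neg_powr) auto
    moreover have "\<forall>\<^sub>F x in at_top. 1 - (x / w\<^sub>0) powr (1 - \<beta>) = weight_cdf \<beta> w\<^sub>0 x"
      using eventually_ge_at_top[of w\<^sub>0] by eventually_elim (auto simp: weight_cdf_def)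
    ultimately have "(weight_cdf \<beta> w\<^sub>0 \<longlongrightarrow> 1 - 0) at_top"
      by (rule Lim_transform_eventually)
    then show "(weight_cdf \<beta> w\<^sub>0 \<longlongrightarrow> 1) at_top"
      by simp
  qed
  then show ?thesis
    by (simp add: weight_law_def real_distribution_def)
qed

lemma sets_weight_law [measurable_cong, simp]: "sets (weight_law \<beta> w\<^sub>0) = sets borel"
  by (simp add: weight_law_def)

section \<open>Ranking vertices by random weights\<close>

lemma measurable_insort_key:
  fixes W :: "'a \<Rightarrow> nat \<Rightarrow> real"
  assumes [measurable]: "\<And>u. (\<lambda>\<omega>. W \<omega> u) \<in> borel_measurable M"
  shows "(\<lambda>\<omega>. insort_key (W \<omega>) u l) \<in> M \<rightarrow>\<^sub>M count_space UNIV"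
proof (induction l)
  case (Cons y ys)
  note [measurable] = measurable_compose[OF Cons.IH, of "Cons y" "count_space UNIV", simplified]
  show ?case by simp
qed simp

text \<open>Each insertion compares weights and acts on a random list. Lists of naturals are
  countable, so measurability may be checked for each fixed list.\<close>

lemma measurable_sort_key:
  fixes W :: "'a \<Rightarrow> nat \<Rightarrow> real"
  assumes "\<And>u. (\<lambda>\<omega>. W \<omega> u) \<in> borel_measurable M"
  shows "(\<lambda>\<omega>. sort_key (W \<omega>) l) \<in> M \<rightarrow>\<^sub>M count_space UNIV"
proof (induction l)
  case (Cons u l)
  have "(\<lambda>\<omega>. insort_key (W \<omega>) u (sort_key (W \<omega>) l)) \<in> M \<rightarrow>\<^sub>M count_space UNIV"
    by (rule measurable_compose_countable[OF measurable_insort_key[OF assms] Cons.IH])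
  then show ?case by simp
qed simp

lemma bij_betw_ranked:
  assumes "finite U"
  shows "bij_betw (ranked w U) {1..card U} U"
proof -
  let ?l = "sort_key w (sorted_list_of_set U)"
  have "bij_betw ((!) ?l) {..<card U} U"
    using assms by (intro bij_betw_nth) auto
  moreover have "bij_betw (\<lambda>i. i - 1) {1..card U} {..<card U}"
    by (rule bij_betwI[where g = Suc]) auto
  ultimately have "bij_betw ((!) ?l \<circ> (\<lambda>i. i - 1)) {1..card U} U"
    by (rule bij_betw_trans[rotated])
  then show ?thesis
    by (simp add: ranked_def[abs_def] comp_def)
qed

text \<open>Renaming vertices by rank turns graph events into conditions on sorted weights and
  positions alone. Injectivity preserves the requirement that adjacent vertices be distinct.\<close>

lemma adjacent_reindex:
  assumes "inj_on f I" "i \<in> I" "j \<in> I"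
  shows "adjacent lam n d (\<lambda>i\<in>I. w (f i)) (\<lambda>i\<in>I. x (f i)) i j \<longleftrightarrow> adjacent lam n d w x (f i) (f j)"
  using assms by (auto simp: adjacent_def inj_on_eq_iff)

lemma is_clique_reindex:
  assumes "bij_betw f I U"
  shows "is_clique lam n d w x U \<longleftrightarrow> is_clique lam n d (\<lambda>i\<in>I. w (f i)) (\<lambda>i\<in>I. x (f i)) I"
proof -
  have U: "U = f ` I" and inj: "inj_on f I" using assms by (auto simp: bij_betw_def)
  then show ?thesis
    unfolding is_clique_def U by (auto simp: adjacent_reindex inj_on_eq_iff)
qed

lemma is_star_reindex:
  assumes "inj_on f {1..k}" "k \<ge> 1"
  shows "is_star lam n d c k w x f \<longleftrightarrow>
    is_star lam n d c k (\<lambda>i\<in>{1..k}. w (f i)) (\<lambda>i\<in>{1..k}. x (f i)) (\<lambda>i. i)"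
  using assms unfolding is_star_def by (simp add: adjacent_reindex)

section \<open>A criterion for conditional probabilities\<close>

text \<open>The sets of the generated sigma-algebra are the preimages of sets \<open>B\<close> of
  \<open>N\<close>. Integrals under \<open>uniform_measure M E\<close> are integrals over
  \<open>E\<close> divided by its mass, so the defining equation can be tested with nonnegative
  integrals over \<open>M\<close>.\<close>

lemma is_cond_probI:
  assumes M: "prob_space M" and V [measurable]: "V \<in> M \<rightarrow>\<^sub>M N"
    and A [measurable]: "A \<in> sets M" and E [measurable]: "E \<in> sets M"
    and p [measurable]: "p \<in> borel_measurable N" and p01: "\<And>v. 0 \<le> p v" "\<And>v. p v \<le> 1"
    and eq: "\<And>B. B \<in> sets N \<Longrightarrow>
      (\<integral>\<^sup>+\<omega>. indicator B (V \<omega>) * indicator A \<omega> * indicator E \<omega> \<partial>M)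
      = (\<integral>\<^sup>+\<omega>. indicator B (V \<omega>) * ennreal (p (V \<omega>)) * indicator E \<omega> \<partial>M)"
  shows "is_cond_prob M A E V N p"
proof (cases "emeasure M E = 0")
  \<comment> \<open>If \<open>E\<close> is null, the claim is vacuous, because it concerns only
    almost all points of \<open>E\<close>.\<close>
  case True
  then have "AE \<omega> in M. \<omega> \<notin> E"
    by (intro AE_not_in) auto
  then show ?thesis
    unfolding is_cond_prob_def by (intro AE_uniform_measureI) auto
next
  case False
  interpret M: prob_space M by fact
  let ?UM = "uniform_measure M E" and ?F = "vimage_algebra (space M) V N"
  interpret UM: prob_space ?UM
    using False by (intro prob_space_uniform_measure) auto
  have VF: "V \<in> ?F \<rightarrow>\<^sub>M N"
    using measurable_space[OF V] by (intro measurable_vimage_algebra1) auto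
  interpret finite_measure_subalgebra ?UM ?F
  proof
    show "subalgebra ?UM ?F"
      unfolding subalgebra_def using sets_image_in_sets[OF refl V] by simp
  qed
  show ?thesis
    unfolding is_cond_prob_def
  proof (rule real_cond_exp_charact)
    have [measurable]: "V \<in> ?UM \<rightarrow>\<^sub>M N" by simp
    show "integrable ?UM (\<lambda>\<omega>. p (V \<omega>))"
      by (rule UM.integrable_const_bound[of _ 1]) (use p01 in auto)
    show "integrable ?UM (indicator A :: _ \<Rightarrow> real)"
      by (rule UM.integrable_const_bound[of _ 1]) (auto simp: indicator_def)
    show "(\<lambda>\<omega>. p (V \<omega>)) \<in> borel_measurable ?F"
      by (rule measurable_compose[OF VF p])
    fix A' assume "A' \<in> sets ?F"
    then obtain B where B [measurable]: "B \<in> sets N" and A': "A' = V -` B \<inter> space M"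
      using sets_vimage_algebra2[of V "space M" N] measurable_space[OF V] by auto
    have set_integral: "(\<integral>\<omega>\<in>A'. f \<omega> \<partial>?UM)
        = enn2real ((\<integral>\<^sup>+\<omega>. indicator B (V \<omega>) * ennreal (f \<omega>) * indicator E \<omega> \<partial>M) / emeasure M E)"
      if [measurable]: "f \<in> borel_measurable M" and "\<And>\<omega>. 0 \<le> f \<omega>" for f :: "_ \<Rightarrow> real"
    proof -
      have "(\<integral>\<omega>\<in>A'. f \<omega> \<partial>?UM) = (\<integral>\<omega>. indicator B (V \<omega>) * f \<omega> \<partial>?UM)"
        unfolding set_lebesgue_integral_def
        by (intro Bochner_Integration.integral_cong) (auto simp: A' indicator_def)
      also have "\<dots> = enn2real (\<integral>\<^sup>+\<omega>. ennreal (indicator B (V \<omega>) * f \<omega>) \<partial>?UM)"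
        using that by (intro integral_eq_nn_integral) auto
      also have "(\<integral>\<^sup>+\<omega>. ennreal (indicator B (V \<omega>) * f \<omega>) \<partial>?UM)
          = (\<integral>\<^sup>+\<omega>. ennreal (indicator B (V \<omega>) * f \<omega>) * indicator E \<omega> \<partial>M) / emeasure M E"
        by (intro nn_integral_uniform_measure) measurable
      also have "(\<integral>\<^sup>+\<omega>. ennreal (indicator B (V \<omega>) * f \<omega>) * indicator E \<omega> \<partial>M)
          = (\<integral>\<^sup>+\<omega>. indicator B (V \<omega>) * ennreal (f \<omega>) * indicator E \<omega> \<partial>M)"
        by (intro nn_integral_cong) (auto simp: indicator_def)
      finally show ?thesis .
    qed
    show "(\<integral>\<omega>\<in>A'. indicator A \<omega> \<partial>?UM) = (\<integral>\<omega>\<in>A'. p (V \<omega>) \<partial>?UM)"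
      using eq[OF B] p01 by (simp add: set_integral ennreal_indicator)
  qed
qed

section \<open>Measurability of the sorted weights and positions\<close>

text \<open>The random index takes values in the finite set \<open>U\<close>, so measurability of
  each component with a fixed index in \<open>U\<close> suffices.\<close>

lemma measurable_at_ranked:
  assumes W: "\<And>u. (\<lambda>\<omega>. W \<omega> u) \<in> borel_measurable M"
    and U: "finite U" "i \<in> {1..card U}"
    and Z: "\<And>u. u \<in> U \<Longrightarrow> (\<lambda>\<omega>. Z \<omega> u) \<in> M \<rightarrow>\<^sub>M K"
  shows "(\<lambda>\<omega>. Z \<omega> (ranked (W \<omega>) U i)) \<in> M \<rightarrow>\<^sub>M K"
proof (rule measurable_compose_countable'[where f = "\<lambda>u \<omega>. Z \<omega> u", OF Z])
  have "(\<lambda>\<omega>. ranked (W \<omega>) U i) \<in> M \<rightarrow>\<^sub>M count_space UNIV"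
    unfolding ranked_def by (rule measurable_compose[OF measurable_sort_key[OF W]]) simp
  moreover have "ranked (W \<omega>) U i \<in> U" for \<omega>
    using bij_betw_apply[OF bij_betw_ranked[OF U(1)] U(2)] .
  ultimately have "(\<lambda>\<omega>. ranked (W \<omega>) U i) \<in> M \<rightarrow>\<^sub>M restrict_space (count_space UNIV) U"
    by (intro measurable_restrict_space2) auto
  then show "(\<lambda>\<omega>. ranked (W \<omega>) U i) \<in> M \<rightarrow>\<^sub>M count_space U"
    by (simp add: restrict_count_space)
qed (use U in \<open>auto intro: countable_finite\<close>)

text \<open>Together with \<open>sorted_weights\<close> this determines whether the clique and the
  star event occur.\<close>

definition sorted_positions ::
    "nat \<Rightarrow> ((nat \<Rightarrow> real) \<times> (nat \<Rightarrow> nat \<Rightarrow> real)) \<times> nat set \<Rightarrow> nat \<Rightarrow> nat \<Rightarrow> real" where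
  "sorted_positions k = (\<lambda>((w, x), U). \<lambda>i\<in>{1..k}. x (ranked w U i))"

text \<open>Outside \<open>I\<close> an element of the product space has the constant value
  \<open>undefined\<close>. Covering these indices matters because the sorting lemmas ask for
  measurability at every index.\<close>

lemma measurable_weight_component:
  "(\<lambda>w. w u) \<in> borel_measurable (Pi\<^sub>M I (\<lambda>_. weight_law \<beta> w\<^sub>0))"
proof (cases "u \<in> I")
  case False
  then have "(\<lambda>w. w u) \<in> borel_measurable (Pi\<^sub>M I (\<lambda>_. weight_law \<beta> w\<^sub>0)) \<longleftrightarrow>
      (\<lambda>w. undefined :: real) \<in> borel_measurable (Pi\<^sub>M I (\<lambda>_. weight_law \<beta> w\<^sub>0))"
    by (intro measurable_cong) (auto simp: space_PiM PiE_def extensional_def)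
  then show ?thesis by simp
qed measurable

lemma measurable_girg_subset:
  assumes "\<And>U. U \<subseteq> {1..n} \<Longrightarrow> card U = k \<Longrightarrow> (\<lambda>p. f (p, U)) \<in> girg n \<beta> w\<^sub>0 d \<rightarrow>\<^sub>M K"
  shows "f \<in> girg_subset n \<beta> w\<^sub>0 d k \<rightarrow>\<^sub>M K"
proof -
  let ?U = "{U. U \<subseteq> {1..n} \<and> card U = k}"
  have "(\<lambda>\<omega>. f (fst \<omega>, snd \<omega>)) \<in> girg_subset n \<beta> w\<^sub>0 d k \<rightarrow>\<^sub>M K"
  proof (rule measurable_compose_countable'[where f = "\<lambda>U \<omega>. f (fst \<omega>, U)" and g = snd and I = ?U])
    show "(\<lambda>\<omega>. f (fst \<omega>, U)) \<in> girg_subset n \<beta> w\<^sub>0 d k \<rightarrow>\<^sub>M K" if "U \<in> ?U" for U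
      using that assms[of U] unfolding girg_subset_def by (intro measurable_compose[OF measurable_fst]) auto
    show "snd \<in> girg_subset n \<beta> w\<^sub>0 d k \<rightarrow>\<^sub>M count_space ?U"
      using measurable_snd unfolding girg_subset_def
        measurable_cong_sets[OF refl sets_uniform_count_measure_count_space, symmetric] .
    show "countable ?U"
      by (rule countable_finite, rule finite_subset[of _ "Pow {1..n}"]) auto
  qed
  then show ?thesis by simp
qed

lemma measurable_sorted_weights:
  "sorted_weights k \<in> girg_subset n \<beta> w\<^sub>0 d k \<rightarrow>\<^sub>M Pi\<^sub>M {1..k} (\<lambda>_. borel)"
proof (rule measurable_girg_subset)
  fix U assume U: "U \<subseteq> {1..n}" "card U = k"
  have W: "(\<lambda>p. fst p u) \<in> borel_measurable (girg n \<beta> w\<^sub>0 d)" for u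
    unfolding girg_def by (rule measurable_compose[OF measurable_fst measurable_weight_component])
  have "(\<lambda>p. \<lambda>i\<in>{1..k}. fst p (ranked (fst p) U i)) \<in> girg n \<beta> w\<^sub>0 d \<rightarrow>\<^sub>M Pi\<^sub>M {1..k} (\<lambda>_. borel)"
    using U finite_subset[OF U(1)] W
    by (intro measurable_restrict measurable_at_ranked[where W = fst and Z = fst]) auto
  then show "(\<lambda>p. sorted_weights k (p, U)) \<in> girg n \<beta> w\<^sub>0 d \<rightarrow>\<^sub>M Pi\<^sub>M {1..k} (\<lambda>_. borel)"
    by (simp add: sorted_weights_def case_prod_unfold)
qed

lemma measurable_sorted_positions:
  "sorted_positions k \<in> girg_subset n \<beta> w\<^sub>0 d k \<rightarrow>\<^sub>M Pi\<^sub>M {1..k} (\<lambda>_. torus_uniform d)"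
proof (rule measurable_girg_subset)
  fix U assume U: "U \<subseteq> {1..n}" "card U = k"
  have W: "(\<lambda>p. fst p u) \<in> borel_measurable (girg n \<beta> w\<^sub>0 d)" for u
    unfolding girg_def by (rule measurable_compose[OF measurable_fst measurable_weight_component])
  have X: "(\<lambda>p. snd p u) \<in> girg n \<beta> w\<^sub>0 d \<rightarrow>\<^sub>M torus_uniform d" if "u \<in> U" for u
    unfolding girg_def using that U
    by (intro measurable_compose[OF measurable_snd measurable_component_singleton]) auto
  have "(\<lambda>p. \<lambda>i\<in>{1..k}. snd p (ranked (fst p) U i))
      \<in> girg n \<beta> w\<^sub>0 d \<rightarrow>\<^sub>M Pi\<^sub>M {1..k} (\<lambda>_. torus_uniform d)"
    using U finite_subset[OF U(1)] W X
    by (intro measurable_restrict measurable_at_ranked[where W = fst and Z = snd]) auto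
  then show "(\<lambda>p. sorted_positions k (p, U)) \<in> girg n \<beta> w\<^sub>0 d \<rightarrow>\<^sub>M Pi\<^sub>M {1..k} (\<lambda>_. torus_uniform d)"
    by (simp add: sorted_positions_def case_prod_unfold)
qed

section \<open>Integration over the graph and the random subset\<close>

lemma prob_space_girg:
  assumes "w\<^sub>0 > 0" "\<beta> > 1"
  shows "prob_space (girg n \<beta> w\<^sub>0 d)"
  unfolding girg_def
  by (intro prob_space_pair prob_space_PiM prob_space_weight_law prob_space_torus_uniform assms)

lemma prob_space_random_subset:
  assumes "k \<le> n"
  shows "prob_space (uniform_count_measure {U. U \<subseteq> {1..n} \<and> card U = k})"
proof (rule prob_space_uniform_count_measure)
  show "finite {U. U \<subseteq> {1..n} \<and> card U = k}"
    by (rule finite_subset[of _ "Pow {1..n}"]) auto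
  have "{1..k} \<in> {U. U \<subseteq> {1..n} \<and> card U = k}" using assms by auto
  then show "{U. U \<subseteq> {1..n} \<and> card U = k} \<noteq> {}" by blast
qed

lemma prob_space_girg_subset:
  assumes "w\<^sub>0 > 0" "\<beta> > 1" "k \<le> n"
  shows "prob_space (girg_subset n \<beta> w\<^sub>0 d k)"
  unfolding girg_subset_def
  by (intro prob_space_pair prob_space_girg prob_space_random_subset assms)

lemma nn_integral_girg_subset:
  assumes "w\<^sub>0 > 0" "\<beta> > 1" "k \<le> n"
    and g: "g \<in> borel_measurable (girg_subset n \<beta> w\<^sub>0 d k)"
  shows "(\<integral>\<^sup>+\<omega>. g \<omega> \<partial>girg_subset n \<beta> w\<^sub>0 d k)
    = (\<integral>\<^sup>+U. (\<integral>\<^sup>+w. (\<integral>\<^sup>+x. g ((w, x), U) \<partial>Pi\<^sub>M {1..n} (\<lambda>_. torus_uniform d))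
        \<partial>Pi\<^sub>M {1..n} (\<lambda>_. weight_law \<beta> w\<^sub>0)) \<partial>uniform_count_measure {U. U \<subseteq> {1..n} \<and> card U = k})"
proof -
  let ?G = "girg n \<beta> w\<^sub>0 d" and ?UC = "uniform_count_measure {U. U \<subseteq> {1..n} \<and> card U = k}"
  interpret G: prob_space ?G by (intro prob_space_girg assms)
  interpret UC: prob_space ?UC by (intro prob_space_random_subset assms)
  interpret X: prob_space "Pi\<^sub>M {1..n} (\<lambda>_. torus_uniform d)"
    by (intro prob_space_PiM prob_space_torus_uniform)
  interpret pair_sigma_finite ?G ?UC ..
  have "(\<integral>\<^sup>+\<omega>. g \<omega> \<partial>girg_subset n \<beta> w\<^sub>0 d k) = (\<integral>\<^sup>+U. (\<integral>\<^sup>+p. g (p, U) \<partial>?G) \<partial>?UC)"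
    unfolding girg_subset_def
    by (rule nn_integral_snd[symmetric]) (use g in \<open>simp add: girg_subset_def\<close>)
  also have "\<dots> = (\<integral>\<^sup>+U. (\<integral>\<^sup>+w. (\<integral>\<^sup>+x. g ((w, x), U) \<partial>Pi\<^sub>M {1..n} (\<lambda>_. torus_uniform d))
        \<partial>Pi\<^sub>M {1..n} (\<lambda>_. weight_law \<beta> w\<^sub>0)) \<partial>?UC)"
  proof (intro nn_integral_cong)
    fix U assume U: "U \<in> space ?UC"
    have "(\<lambda>p. g (p, U)) \<in> borel_measurable ?G"
      using g U unfolding girg_subset_def by (intro measurable_Pair1)
    then show "(\<integral>\<^sup>+p. g (p, U) \<partial>?G) = (\<integral>\<^sup>+w. (\<integral>\<^sup>+x. g ((w, x), U) \<partial>Pi\<^sub>M {1..n} (\<lambda>_. torus_uniform d))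
        \<partial>Pi\<^sub>M {1..n} (\<lambda>_. weight_law \<beta> w\<^sub>0))"
      unfolding girg_def by (rule X.nn_integral_fst[symmetric])
  qed
  finally show ?thesis .
qed

text \<open>The positions of the chosen vertices, listed by increasing weight, are uniform and independent of
  the weights, although the order depends on the weights.\<close>

lemma nn_integral_sorted:
  assumes "w\<^sub>0 > 0" "\<beta> > 1" "k \<le> n"
    and f [measurable]: "f \<in> borel_measurable (Pi\<^sub>M {1..k} (\<lambda>_. borel) \<Otimes>\<^sub>M Pi\<^sub>M {1..k} (\<lambda>_. torus_uniform d))"
  shows "(\<integral>\<^sup>+\<omega>. f (sorted_weights k \<omega>, sorted_positions k \<omega>) \<partial>girg_subset n \<beta> w\<^sub>0 d k)
    = (\<integral>\<^sup>+\<omega>. (\<integral>\<^sup>+y. f (sorted_weights k \<omega>, y) \<partial>Pi\<^sub>M {1..k} (\<lambda>_. torus_uniform d)) \<partial>girg_subset n \<beta> w\<^sub>0 d k)"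
proof -
  let ?M = "girg_subset n \<beta> w\<^sub>0 d k" and ?T = "Pi\<^sub>M {1..k} (\<lambda>_. torus_uniform d)"
    and ?X = "Pi\<^sub>M {1..n} (\<lambda>_. torus_uniform d)" and ?N = "Pi\<^sub>M {1..k} (\<lambda>_. borel :: real measure)"
  interpret T: prob_space ?T by (intro prob_space_PiM prob_space_torus_uniform)
  interpret X: prob_space ?X by (intro prob_space_PiM prob_space_torus_uniform)
  note [measurable] = measurable_sorted_weights measurable_sorted_positions
  have meas1: "(\<lambda>\<omega>. f (sorted_weights k \<omega>, sorted_positions k \<omega>)) \<in> borel_measurable ?M"
    by measurable
  have "(\<lambda>v. \<integral>\<^sup>+y. f (v, y) \<partial>?T) \<in> borel_measurable ?N"
    by measurable
  then have meas2: "(\<lambda>\<omega>. \<integral>\<^sup>+y. f (sorted_weights k \<omega>, y) \<partial>?T) \<in> borel_measurable ?M"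
    by (rule measurable_compose[OF measurable_sorted_weights])
  have inner: "(\<integral>\<^sup>+x. f (sorted_weights k ((w, x), U), sorted_positions k ((w, x), U)) \<partial>?X)
      = (\<integral>\<^sup>+x. (\<integral>\<^sup>+y. f (sorted_weights k ((w, x), U), y) \<partial>?T) \<partial>?X)"
    if U: "U \<subseteq> {1..n}" "card U = k" for w U
  proof -
    define v where "v = (\<lambda>i\<in>{1..k}. w (ranked w U i))"
    have v: "v \<in> space ?N" by (simp add: v_def space_PiM)
    have sw: "sorted_weights k ((w, x), U) = v" for x
      by (simp add: sorted_weights_def v_def)
    have bij: "bij_betw (ranked w U) {1..k} U"
      using bij_betw_ranked[of U w] finite_subset[OF U(1)] U(2) by auto
    have mem: "ranked w U i \<in> {1..n}" if "i \<in> {1..k}" for i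
      using bij_betw_apply[OF bij that] U(1) by blast
    have fv: "(\<lambda>y. f (v, y)) \<in> borel_measurable ?T"
      using f v by (rule measurable_Pair2)
    \<comment> \<open>Once \<open>w\<close> and \<open>U\<close> are fixed, the ranking is a fixed
      injection, and selecting distinct coordinates of an i.i.d. family gives an i.i.d.
      family.\<close>
    have reindex: "distr ?X ?T (\<lambda>x. \<lambda>i\<in>{1..k}. x (ranked w U i)) = ?T"
      using bij U by (intro distr_PiM_reindex prob_space_torus_uniform) (auto simp: bij_betw_def)
    have "(\<integral>\<^sup>+x. f (sorted_weights k ((w, x), U), sorted_positions k ((w, x), U)) \<partial>?X)
        = (\<integral>\<^sup>+x. f (v, \<lambda>i\<in>{1..k}. x (ranked w U i)) \<partial>?X)"
      by (simp add: sw sorted_positions_def)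
    also have "\<dots> = (\<integral>\<^sup>+y. f (v, y) \<partial>distr ?X ?T (\<lambda>x. \<lambda>i\<in>{1..k}. x (ranked w U i)))"
    proof (rule nn_integral_distr[symmetric])
      show "(\<lambda>x. \<lambda>i\<in>{1..k}. x (ranked w U i)) \<in> ?X \<rightarrow>\<^sub>M ?T"
        using mem by (intro measurable_restrict measurable_component_singleton)
    qed (use fv in simp)
    also have "\<dots> = (\<integral>\<^sup>+y. f (v, y) \<partial>?T)"
      by (simp only: reindex)
    \<comment> \<open>On the right the integrand is constant in \<open>x\<close>, so integrating
      over the probability space \<open>?X\<close> changes nothing.\<close>
    finally show ?thesis
      by (simp add: sw X.emeasure_space_1[simplified])
  qed
  show ?thesis
    unfolding nn_integral_girg_subset[OF assms(1-3) meas1] nn_integral_girg_subset[OF assms(1-3) meas2]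
    by (intro nn_integral_cong inner) (auto simp: space_uniform_count_measure)
qed

text \<open>Both events are conditions on the sorted weights \<open>V\<close> and positions
  \<open>Y\<close>, and \<open>Y\<close> is independent of \<open>V\<close>. Integrating out
  \<open>Y\<close> turns the joint event into \<open>C V\<close> and the star into
  \<open>D V\<close>, and \<open>clique_prob\<close> is the quotient \<open>C / D\<close>.\<close>

lemma is_cond_prob_clique_prob:
  assumes w0: "w\<^sub>0 > 0" and b: "\<beta> > 1" and d: "d \<ge> 1" and k: "1 \<le> k" "k \<le> n"
  shows "is_cond_prob (girg_subset n \<beta> w\<^sub>0 d k)
           (clique_event lam n \<beta> w\<^sub>0 d k) (star_event lam n \<beta> w\<^sub>0 d c k)
           (sorted_weights k) (Pi\<^sub>M {1..k} (\<lambda>_. borel)) (clique_prob lam n d c k)"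
proof -
  let ?M = "girg_subset n \<beta> w\<^sub>0 d k" and ?T = "Pi\<^sub>M {1..k} (\<lambda>_. torus_uniform d)"
    and ?N = "Pi\<^sub>M {1..k} (\<lambda>_. borel :: real measure)"
  let ?V = "sorted_weights k" and ?Y = "sorted_positions k"
  let ?A = "clique_event lam n \<beta> w\<^sub>0 d k" and ?E = "star_event lam n \<beta> w\<^sub>0 d c k"
  interpret T: prob_space ?T by (intro prob_space_PiM prob_space_torus_uniform)
  note VY [measurable] = measurable_sorted_weights measurable_sorted_positions
  define Q where "Q v y \<longleftrightarrow> is_clique lam n d v y {1..k}" for v y
  define R where "R v y \<longleftrightarrow> is_star lam n d c k v y (\<lambda>i. i)" for v y
  have comp: "(\<lambda>q. fst q u) \<in> borel_measurable (?N \<Otimes>\<^sub>M ?T)" "(\<lambda>q. snd q u) \<in> ?N \<Otimes>\<^sub>M ?T \<rightarrow>\<^sub>M torus_uniform d"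
    if "u \<in> {1..k}" for u
    using that by measurable
  have Q [measurable]: "Measurable.pred (?N \<Otimes>\<^sub>M ?T) (\<lambda>q. Q (fst q) (snd q))"
    unfolding Q_def using comp by (intro pred_is_clique d) auto
  have R [measurable]: "Measurable.pred (?N \<Otimes>\<^sub>M ?T) (\<lambda>q. R (fst q) (snd q))"
    unfolding R_def using comp by (intro pred_is_star d k) auto
  have bij: "bij_betw (ranked w U) {1..k} U" if "((w, x), U) \<in> space ?M" for w x U
  proof -
    have "U \<subseteq> {1..n}" "card U = k"
      using that by (auto simp: girg_subset_def space_pair_measure space_uniform_count_measure)
    then show ?thesis
      using bij_betw_ranked[of U w] finite_subset[of U "{1..n}"] by auto
  qed
  have A: "?A = {\<omega>\<in>space ?M. Q (?V \<omega>) (?Y \<omega>)}"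
    unfolding clique_event_def Q_def
    by (auto simp: sorted_weights_def sorted_positions_def is_clique_reindex[OF bij])
  have E: "?E = {\<omega>\<in>space ?M. R (?V \<omega>) (?Y \<omega>)}"
    unfolding star_event_def R_def
    using is_star_reindex[OF bij_betw_imp_inj_on[OF bij] k(1), of _ _ _ lam n d c]
    by (auto simp: sorted_weights_def sorted_positions_def)
  have VY_pair: "(\<lambda>\<omega>. (?V \<omega>, ?Y \<omega>)) \<in> ?M \<rightarrow>\<^sub>M ?N \<Otimes>\<^sub>M ?T"
    by measurable
  have A_sets: "?A \<in> sets ?M"
    unfolding A using measurable_compose[OF VY_pair Q] by simp
  have E_sets: "?E \<in> sets ?M"
    unfolding E using measurable_compose[OF VY_pair R] by simp
  define D where "D v = measure ?T {y\<in>space ?T. R v y}" for v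
  define C where "C v = measure ?T {y\<in>space ?T. Q v y \<and> R v y}" for v
  have p: "clique_prob lam n d c k v = C v / D v" for v
    by (simp add: clique_prob_def cond_prob_def C_def D_def Q_def R_def)
  \<comment> \<open>This is shown for every \<open>v\<close>, also outside the space of
    \<open>?N\<close>, because \<open>is_cond_probI\<close> asks for values between 0 and 1
    everywhere.\<close>
  have fibre_sets: "{y\<in>space ?T. R v y} \<in> sets ?T" for v
  proof -
    have "Measurable.pred ?T (R v)"
      unfolding R_def by (intro pred_is_star d k measurable_component_singleton) auto
    then show ?thesis by simp
  qed
  have CD: "0 \<le> C v" "0 \<le> D v" "C v \<le> D v" for v
    unfolding C_def D_def by (auto intro: T.finite_measure_mono[OF _ fibre_sets, simplified])
  have fibre_meas: "(\<lambda>v. emeasure ?T {y\<in>space ?T. P v y}) \<in> borel_measurable ?N"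
    if P [measurable]: "Measurable.pred (?N \<Otimes>\<^sub>M ?T) (\<lambda>q. P (fst q) (snd q))" for P
  proof (rule T.measurable_emeasure)
    have "{q\<in>space (?N \<Otimes>\<^sub>M ?T). snd q \<in> {y\<in>space ?T. P (fst q) y}}
        = {q\<in>space (?N \<Otimes>\<^sub>M ?T). P (fst q) (snd q)}"
      by (auto simp: space_pair_measure)
    also have "\<dots> \<in> sets (?N \<Otimes>\<^sub>M ?T)"
      by measurable
    finally show "{q\<in>space (?N \<Otimes>\<^sub>M ?T). snd q \<in> {y\<in>space ?T. P (fst q) y}} \<in> sets (?N \<Otimes>\<^sub>M ?T)" .
  qed auto
  have [measurable]: "C \<in> borel_measurable ?N" "D \<in> borel_measurable ?N"
    using fibre_meas[of R] fibre_meas[of "\<lambda>v y. Q v y \<and> R v y"]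
    unfolding C_def[abs_def] D_def[abs_def] measure_def by measurable
  have fubini: "(\<integral>\<^sup>+\<omega>. g (?V \<omega>) * indicator {\<omega>\<in>space ?M. P (?V \<omega>) (?Y \<omega>)} \<omega> \<partial>?M)
      = (\<integral>\<^sup>+\<omega>. g (?V \<omega>) * emeasure ?T {y\<in>space ?T. P (?V \<omega>) y} \<partial>?M)"
    if g [measurable]: "g \<in> borel_measurable ?N"
      and P [measurable]: "Measurable.pred (?N \<Otimes>\<^sub>M ?T) (\<lambda>q. P (fst q) (snd q))" for g P
  proof -
    define f where "f q = g (fst q) * indicator {q\<in>space (?N \<Otimes>\<^sub>M ?T). P (fst q) (snd q)} q" for q
    have f: "f \<in> borel_measurable (?N \<Otimes>\<^sub>M ?T)"
      unfolding f_def by measurable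
    have "(\<integral>\<^sup>+\<omega>. g (?V \<omega>) * indicator {\<omega>\<in>space ?M. P (?V \<omega>) (?Y \<omega>)} \<omega> \<partial>?M)
        = (\<integral>\<^sup>+\<omega>. f (?V \<omega>, ?Y \<omega>) \<partial>?M)"
      using measurable_space[OF VY_pair] by (intro nn_integral_cong) (auto simp: f_def indicator_def)
    also have "\<dots> = (\<integral>\<^sup>+\<omega>. (\<integral>\<^sup>+y. f (?V \<omega>, y) \<partial>?T) \<partial>?M)"
      by (rule nn_integral_sorted[OF w0 b k(2) f])
    also have "\<dots> = (\<integral>\<^sup>+\<omega>. g (?V \<omega>) * emeasure ?T {y\<in>space ?T. P (?V \<omega>) y} \<partial>?M)"
    proof (intro nn_integral_cong)
      fix \<omega> assume "\<omega> \<in> space ?M"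
      then have v: "?V \<omega> \<in> space ?N"
        by (rule measurable_space[OF measurable_sorted_weights])
      have S: "{y\<in>space ?T. P (?V \<omega>) y} \<in> sets ?T"
        using measurable_Pair2[OF P v] by simp
      have "(\<integral>\<^sup>+y. f (?V \<omega>, y) \<partial>?T) = (\<integral>\<^sup>+y. g (?V \<omega>) * indicator {y\<in>space ?T. P (?V \<omega>) y} y \<partial>?T)"
        using v by (intro nn_integral_cong) (auto simp: f_def indicator_def space_pair_measure)
      also have "\<dots> = g (?V \<omega>) * emeasure ?T {y\<in>space ?T. P (?V \<omega>) y}"
        using S by (rule nn_integral_cmult_indicator)
      finally show "(\<integral>\<^sup>+y. f (?V \<omega>, y) \<partial>?T) = g (?V \<omega>) * emeasure ?T {y\<in>space ?T. P (?V \<omega>) y}" .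
    qed
    finally show ?thesis .
  qed
  show ?thesis
  proof (rule is_cond_probI[OF prob_space_girg_subset[OF w0 b k(2)] measurable_sorted_weights A_sets E_sets])
    show "clique_prob lam n d c k \<in> borel_measurable ?N"
      unfolding p[abs_def] by measurable
    show "0 \<le> clique_prob lam n d c k v" "clique_prob lam n d c k v \<le> 1" for v
      unfolding p using CD[of v] by (auto simp: divide_le_eq_1)
    fix B assume B [measurable]: "B \<in> sets ?N"
    have "(\<integral>\<^sup>+\<omega>. indicator B (?V \<omega>) * indicator ?A \<omega> * indicator ?E \<omega> \<partial>?M)
        = (\<integral>\<^sup>+\<omega>. indicator B (?V \<omega>) * indicator {\<omega>\<in>space ?M. Q (?V \<omega>) (?Y \<omega>) \<and> R (?V \<omega>) (?Y \<omega>)} \<omega> \<partial>?M)"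
      unfolding A E by (intro nn_integral_cong) (auto simp: indicator_def)
    also have "\<dots> = (\<integral>\<^sup>+\<omega>. indicator B (?V \<omega>) * ennreal (C (?V \<omega>)) \<partial>?M)"
      unfolding C_def T.emeasure_eq_measure[symmetric] by (rule fubini) measurable
    also have "\<dots> = (\<integral>\<^sup>+\<omega>. (indicator B (?V \<omega>) * ennreal (C (?V \<omega>) / D (?V \<omega>))) * ennreal (D (?V \<omega>)) \<partial>?M)"
    proof (intro nn_integral_cong)
      \<comment> \<open>If \<open>D v = 0\<close>, then \<open>C v = 0\<close> as well, so the
        identity survives division by zero.\<close>
      have "C v = C v / D v * D v" for v
        using CD[of v] by (cases "D v = 0") auto
      then have "ennreal (C v) = ennreal (C v / D v) * ennreal (D v)" for v
        using CD by (metis ennreal_mult divide_nonneg_nonneg)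
      then show "indicator B (?V \<omega>) * ennreal (C (?V \<omega>))
          = (indicator B (?V \<omega>) * ennreal (C (?V \<omega>) / D (?V \<omega>))) * ennreal (D (?V \<omega>))" for \<omega>
        by (simp add: mult.assoc)
    qed
    also have "\<dots> = (\<integral>\<^sup>+\<omega>. (indicator B (?V \<omega>) * ennreal (C (?V \<omega>) / D (?V \<omega>))) * indicator ?E \<omega> \<partial>?M)"
      \<comment> \<open>Refolding \<open>D\<close> leaves it intact inside the quotient, which plays
        the part of \<open>g\<close>; only the last factor becomes a fibre volume for
        \<open>fubini\<close>.\<close>
      unfolding E D_def T.emeasure_eq_measure[symmetric] unfolding D_def[symmetric]
      by (rule fubini[symmetric]) measurable
    finally show "(\<integral>\<^sup>+\<omega>. indicator B (?V \<omega>) * indicator ?A \<omega> * indicator ?E \<omega> \<partial>?M)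
        = (\<integral>\<^sup>+\<omega>. indicator B (?V \<omega>) * ennreal (clique_prob lam n d c k (?V \<omega>)) * indicator ?E \<omega> \<partial>?M)"
      unfolding p .
  qed
qed

theorem lemma11:
  fixes lam w\<^sub>0 \<beta> c :: real and n d k :: nat
  assumes "lam > 0" and "w\<^sub>0 > 0" and "\<beta> > 2" and "d \<ge> 1"
    and "1 \<le> k" and "k \<le> n" and "c \<ge> 1"
  shows "is_cond_prob (girg_subset n \<beta> w\<^sub>0 d k)
           (clique_event lam n \<beta> w\<^sub>0 d k) (star_event lam n \<beta> w\<^sub>0 d c k)
           (sorted_weights k) (Pi\<^sub>M {1..k} (\<lambda>_. borel)) (clique_prob lam n d c k)
    \<and> (\<forall>w. \<forall>i\<in>{2..k}.
         mono_on {s. admissible lam n w\<^sub>0 d c k (w(i := s))}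
           (\<lambda>s. clique_prob lam n d c k (w(i := s))))"
proof (intro conjI allI ballI mono_onI)
  show "is_cond_prob (girg_subset n \<beta> w\<^sub>0 d k)
           (clique_event lam n \<beta> w\<^sub>0 d k) (star_event lam n \<beta> w\<^sub>0 d c k)
           (sorted_weights k) (Pi\<^sub>M {1..k} (\<lambda>_. borel)) (clique_prob lam n d c k)"
    using assms by (intro is_cond_prob_clique_prob) auto
qed (use assms in \<open>auto intro: clique_prob_mono\<close>)

end
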